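(* Let $n\ge1$, let $a_1,\dots,a_n\ge0$, $a_0=0$, and let $\beta_i,\lambda_i>0$, $i=1,\dots,n$. Define $X_0(t)=t$ and, for $i=1,\dots,n$, $$X_i(t)=E_i\bigl(a_it+N_i(X_{i-1}(t))\bigr),\qquad t\ge0,$$ where $E_1,\dots,E_n$ are exponential processes with parameters $\beta_1,\dots,\beta_n$, $N_1,\dots,N_n$ are Poisson processes with intensities $\lambda_1,\dots,\lambda_n$, and all these processes are independent. Let $\nu_n(du)$ (on $u>0$) and $f_n(u)$ denote the Lévy measure and the Bernstein function (Laplace exponent) of the Lévy process $X_n$. Then: (i) if $\beta_i=\lambda_i=1$ for $i=1,\dots,n$, then $$\nu_n(du)=\left(u^{-1}\sum_{k=0}^{n-1}e^{-u\frac{1}{1+k}}(a_{n-k}-a_{n-k-1})+e^{-u\frac1n}\frac{1}{n^2}\right)du,$$ $$f_n(u)=\sum_{k=0}^{n-1}(a_{n-k}-a_{n-k-1})\log(1+u(1+k))+\frac{u}{1+nu};$$ (ii) if $\beta_i=\beta\ne1$ and $\lambda_i=\lambda\neq1$ for $i=1,\dots,n$, then $$\nu_n(du)=\left(u^{-1}\sum_{k=0}^{n-1}e^{-u\frac{\beta^{k+1}}{\gamma(\lambda,\beta,k+1)}}(a_{n-k}-a_{n-k-1})+e^{-u\frac{\beta^n}{\gamma(\lambda,\beta,n)}}\frac{(\lambda\beta)^n}{(\gamma(\lambda,\beta,n))^2}\right)du,$$ $$f_n(u)=\sum_{k=0}^{n-1}(a_{n-k}-a_{n-k-1})\log\left(1+u\frac{\gamma(\lambda,\beta,k+1)}{\beta^{k+1}}\right)+\lambda^n\frac{u}{\beta^n+u\gamma(\lambda,\beta,n)},$$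 where $\gamma(\lambda,\beta,m)=\sum_{j=1}^{m}\lambda^{m-j}\beta^{j-1}$ (which equals $(\lambda^m-\beta^m)(\lambda-\beta)^{-1}$ when $\lambda\ne\beta$).
   Context: The exponential process with parameter $\beta$ is the subordinator with Laplace exponent $\log(1+u/\beta)$ (the Gamma process with shape parameter $1$ and rate $\beta$). The Laplace exponent $f$ of a subordinator $X$ is defined by $E e^{-uX(t)}=e^{-tf(u)}$, $u\ge 0$, and here (no drift) it is related to the Lévy measure by $f(u)=\int_0^\infty(1-e^{-us})\nu(ds)$. *)

theory Defs
  imports "HOL-Probability.Probability"
begin

text \<open>
  Path properties are required of every sample path (not just almost every one), so that a
  process evaluated at a random time is again measurable without completing the probability
  space. Left limits come for free from monotonicity.
\<close>

definition subordinator :: "'a measure \<Rightarrow> (real \<Rightarrow> 'a \<Rightarrow> real) \<Rightarrow> bool" where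
  "subordinator M X \<longleftrightarrow>
     (\<forall>t\<ge>0. X t \<in> borel_measurable M) \<and>
     (\<forall>\<omega>\<in>space M. X 0 \<omega> = 0) \<and>
     (\<forall>\<omega>\<in>space M. mono_on {0..} (\<lambda>t. X t \<omega>)) \<and>
     (\<forall>\<omega>\<in>space M. \<forall>t\<ge>0. continuous (at_right t) (\<lambda>s. X s \<omega>)) \<and>
     (\<forall>t\<ge>0. \<forall>h\<ge>0. distr M borel (\<lambda>\<omega>. X (t + h) \<omega> - X t \<omega>) = distr M borel (X h)) \<and>
     (\<forall>(m::nat) (t :: nat \<Rightarrow> real). 0 \<le> t 0 \<longrightarrow> (\<forall>i<m. t i \<le> t (Suc i)) \<longrightarrow>
        prob_space.indep_vars M (\<lambda>_. borel) (\<lambda>i \<omega>. X (t (Suc i)) \<omega> - X (t i) \<omega>) {..<m})"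

definition has_laplace_exponent :: "'a measure \<Rightarrow> (real \<Rightarrow> 'a \<Rightarrow> real) \<Rightarrow> (real \<Rightarrow> real) \<Rightarrow> bool" where
  "has_laplace_exponent M X f \<longleftrightarrow>
     (\<forall>t\<ge>0. \<forall>u\<ge>0. (\<integral>\<omega>. exp (- u * X t \<omega>) \<partial>M) = exp (- t * f u))"

text \<open>
  The Levy measure of a subordinator without drift. It is modelled as a Borel measure on the
  whole real line that does not charge the complement of the open half-line of positive reals.
\<close>

definition has_levy_measure :: "'a measure \<Rightarrow> (real \<Rightarrow> 'a \<Rightarrow> real) \<Rightarrow> real measure \<Rightarrow> bool" where
  "has_levy_measure M X \<nu> \<longleftrightarrow>
     sets \<nu> = sets borel \<and> emeasure \<nu> {..0} = 0 \<and> integrable \<nu> (\<lambda>s. min 1 s) \<and>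
     has_laplace_exponent M X (\<lambda>u. \<integral>s. (1 - exp (- u * s)) \<partial>\<nu>)"

text \<open>
  Nonnegativity is explicit because the conversion to extended nonnegative reals truncates
  negative values to zero.
\<close>

definition has_levy_density :: "'a measure \<Rightarrow> (real \<Rightarrow> 'a \<Rightarrow> real) \<Rightarrow> (real \<Rightarrow> real) \<Rightarrow> bool" where
  "has_levy_density M X g \<longleftrightarrow>
     (\<forall>s>0. 0 \<le> g s) \<and>
     has_levy_measure M X (density lborel (\<lambda>s. ennreal (g s) * indicator {0<..} s))"

definition exponential_process :: "'a measure \<Rightarrow> real \<Rightarrow> (real \<Rightarrow> 'a \<Rightarrow> real) \<Rightarrow> bool" where
  "exponential_process M \<beta> E \<longleftrightarrow>
     subordinator M E \<and> has_laplace_exponent M E (\<lambda>u. ln (1 + u / \<beta>))"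

text \<open>The library's Poisson distribution needs a positive rate, hence \<open>t > 0\<close> below.\<close>

definition poisson_process :: "'a measure \<Rightarrow> real \<Rightarrow> (real \<Rightarrow> 'a \<Rightarrow> nat) \<Rightarrow> bool" where
  "poisson_process M l N \<longleftrightarrow>
     subordinator M (\<lambda>t \<omega>. real (N t \<omega>)) \<and>
     (\<forall>t>0. distr M (count_space UNIV) (N t) = measure_pmf (poisson_pmf (l * t)))"

text \<open>
  Joint independence of the \<open>2n\<close> processes, each regarded as one random element of the product
  space of real functions on the time axis \<open>{0..}\<close>.
\<close>

definition independent_processes ::
  "'a measure \<Rightarrow> nat \<Rightarrow> (nat \<Rightarrow> real \<Rightarrow> 'a \<Rightarrow> real) \<Rightarrow> (nat \<Rightarrow> real \<Rightarrow> 'a \<Rightarrow> nat) \<Rightarrow> bool" where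
  "independent_processes M n E N \<longleftrightarrow>
     prob_space.indep_vars M (\<lambda>_. PiM {0..} (\<lambda>_. borel))
       (\<lambda>j \<omega>. \<lambda>t\<in>{0..}. case j of Inl i \<Rightarrow> E i t \<omega> | Inr i \<Rightarrow> real (N i t \<omega>))
       ({1..n} <+> {1..n})"

primrec iterated_process ::
  "(nat \<Rightarrow> real) \<Rightarrow> (nat \<Rightarrow> real \<Rightarrow> 'a \<Rightarrow> real) \<Rightarrow> (nat \<Rightarrow> real \<Rightarrow> 'a \<Rightarrow> nat) \<Rightarrow>
    nat \<Rightarrow> real \<Rightarrow> 'a \<Rightarrow> real" where
  "iterated_process a E N 0 = (\<lambda>t \<omega>. t)"
| "iterated_process a E N (Suc i) =
     (\<lambda>t \<omega>. E (Suc i) (a (Suc i) * t + real (N (Suc i) (iterated_process a E N i t \<omega>) \<omega>)) \<omega>)"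

definition gamma_sum :: "real \<Rightarrow> real \<Rightarrow> nat \<Rightarrow> real" where
  "gamma_sum l b m = (\<Sum>j=1..m. l ^ (m - j) * b ^ (j - 1))"

end

theory Submission
  imports Defs
begin

text \<open>
  If \<open>X\<close> and \<open>Y\<close> are independent subordinators, conditioning on the path of \<open>X\<close> turns the
  increments of \<open>Y (X t)\<close> into increments of \<open>Y\<close> over deterministic intervals, so that
  \<open>E (\<Prod>i. g\<^sub>i (increment\<^sub>i))\<close> factorises; hence \<open>Y (X t)\<close> is a subordinator with exponent
  \<open>f\<^sub>X (f\<^sub>Y u)\<close>. For the processes at hand this gives the recursion
  \<open>f\<^sub>n u = a\<^sub>n ln (1 + u / \<beta>) + f\<^sub>n\<^sub>-\<^sub>1 (\<lambda> u / (\<beta> + u))\<close>, which is solved by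
  \<open>1 + v \<gamma>\<^sub>m / \<beta>\<^sup>m = (1 + u \<gamma>\<^sub>m\<^sub>+\<^sub>1 / \<beta>\<^sup>m\<^sup>+\<^sup>1) / (1 + u / \<beta>)\<close> for \<open>v = \<lambda> u / (\<beta> + u)\<close>.
  The Levy density is read off termwise from Frullani's integral; it is nonnegative by
  summation by parts, because \<open>\<beta>\<^sup>m / \<gamma>\<^sub>m\<close> decreases in \<open>m\<close>. Part (i) is the case
  \<open>\<beta> = \<lambda> = 1\<close>, where \<open>\<gamma>\<^sub>m = m\<close>.
\<close>

subsection \<open>Paths evaluated at random times\<close>

abbreviation path_space :: "(real \<Rightarrow> real) measure" where
  "path_space \<equiv> PiM {0..} (\<lambda>_. borel)"

definition path_of :: "(real \<Rightarrow> 'a \<Rightarrow> real) \<Rightarrow> 'a \<Rightarrow> real \<Rightarrow> real" where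
  "path_of X \<omega> = (\<lambda>t\<in>{0..}. X t \<omega>)"

lemma path_of_apply [simp]: "0 \<le> t \<Longrightarrow> path_of X \<omega> t = X t \<omega>"
  by (simp add: path_of_def)

text \<open>
  Evaluation \<open>(w, s) \<mapsto> w s\<close> is not jointly measurable on the product space of paths. For
  right-continuous paths it agrees with \<open>right_eval\<close>, a limit along grid points strictly above
  \<open>s\<close>, which is. The maximum with \<open>0\<close> keeps the grid inside the time axis.
\<close>

definition grid_above :: "nat \<Rightarrow> real \<Rightarrow> real" where
  "grid_above k s = (real_of_int \<lfloor>real (Suc k) * s\<rfloor> + 1) / real (Suc k)"

definition right_eval :: "(real \<Rightarrow> real) \<Rightarrow> real \<Rightarrow> real" where
  "right_eval w s = lim (\<lambda>k. w (max 0 (grid_above k s)))"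

section \<open>Right limits along the grid, and measurability of evaluation\<close>

lemma subordinatorD:
  assumes "subordinator M X"
  shows "\<And>t. 0 \<le> t \<Longrightarrow> X t \<in> borel_measurable M"
    and "\<And>\<omega>. \<omega> \<in> space M \<Longrightarrow> X 0 \<omega> = 0"
    and "\<And>\<omega>. \<omega> \<in> space M \<Longrightarrow> mono_on {0..} (\<lambda>t. X t \<omega>)"
    and "\<And>\<omega> t. \<omega> \<in> space M \<Longrightarrow> 0 \<le> t \<Longrightarrow> continuous (at_right t) (\<lambda>s. X s \<omega>)"
    and "\<And>t h. 0 \<le> t \<Longrightarrow> 0 \<le> h \<Longrightarrow>
      distr M borel (\<lambda>\<omega>. X (t + h) \<omega> - X t \<omega>) = distr M borel (X h)"
  using assms unfolding subordinator_def by simp_all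

lemma grid_above_bounds: "s < grid_above k s" "grid_above k s \<le> s + 1 / real (Suc k)"
proof -
  have "real (Suc k) * s < real_of_int \<lfloor>real (Suc k) * s\<rfloor> + 1" by linarith
  then show "s < grid_above k s"
    unfolding grid_above_def by (simp add: less_divide_eq mult.commute)
  have "real_of_int \<lfloor>real (Suc k) * s\<rfloor> + 1 \<le> real (Suc k) * s + 1" by linarith
  then have "grid_above k s \<le> (real (Suc k) * s + 1) / real (Suc k)"
    unfolding grid_above_def by (intro divide_right_mono) auto
  then show "grid_above k s \<le> s + 1 / real (Suc k)"
    by (simp add: add_divide_distrib del: of_nat_Suc)
qed

text \<open>Grid points lie strictly above \<open>s\<close>, so the approach is one-sided and
  right-continuity alone controls the values along it.\<close>

lemma filterlim_grid_above: "filterlim (\<lambda>k. grid_above k s) (at_right s) sequentially"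
proof -
  have "(\<lambda>k. s + 1 / real (Suc k)) \<longlonglongrightarrow> s + 0"
    by (intro tendsto_add tendsto_const LIMSEQ_Suc lim_1_over_n)
  then have upper: "(\<lambda>k. s + 1 / real (Suc k)) \<longlonglongrightarrow> s" by (simp only: add_0_right)
  have "(\<lambda>k. grid_above k s) \<longlonglongrightarrow> s"
  proof (rule tendsto_sandwich[OF _ _ tendsto_const upper])
    show "\<forall>\<^sub>F k in sequentially. s \<le> grid_above k s"
      by (intro always_eventually allI less_imp_le grid_above_bounds)
    show "\<forall>\<^sub>F k in sequentially. grid_above k s \<le> s + 1 / real (Suc k)"
      by (intro always_eventually allI grid_above_bounds)
  qed
  moreover have "\<forall>\<^sub>F k in sequentially. grid_above k s \<in> {s<..} \<and> grid_above k s \<noteq> s"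
    using grid_above_bounds(1)[of s] by (intro always_eventually allI) (metis greaterThan_iff less_irrefl)
  ultimately show ?thesis
    by (simp add: filterlim_at)
qed

lemma right_eval_eq:
  assumes "continuous (at_right s) w" "0 \<le> s"
  shows "right_eval w s = w s"
proof -
  have "(w \<longlongrightarrow> w s) (at_right s)"
    using assms(1) by (simp add: continuous_within)
  then have "(\<lambda>k. w (grid_above k s)) \<longlonglongrightarrow> w s"
    using filterlim_grid_above by (rule filterlim_compose)
  moreover have "max 0 (grid_above k s) = grid_above k s" for k
    using grid_above_bounds(1)[of s k] assms(2) by simp
  ultimately show ?thesis
    unfolding right_eval_def by (simp add: limI)
qed

lemma right_eval_path_of:
  assumes "continuous (at_right s) (\<lambda>t. X t \<omega>)" "0 \<le> s"
  shows "right_eval (path_of X \<omega>) s = X s \<omega>"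
proof -
  \<comment> \<open>All arguments used by \<open>right_eval\<close> are nonnegative, where
    \<open>path_of X \<omega>\<close> and the path of \<open>X\<close> coincide.\<close>
  have "right_eval (path_of X \<omega>) s = right_eval (\<lambda>t. X t \<omega>) s"
    by (simp add: right_eval_def)
  with right_eval_eq[OF assms] show ?thesis by simp
qed

text \<open>For fixed \<open>k\<close> the grid point depends on \<open>s\<close> only through an
  integer. This gives countably many pieces, on each of which evaluation is a fixed coordinate of
  the path; the pointwise \<open>lim\<close> then preserves measurability.\<close>

lemma measurable_right_eval [measurable]:
  "(\<lambda>x. right_eval (fst x) (snd x)) \<in> borel_measurable (path_space \<Otimes>\<^sub>M borel)"
  unfolding right_eval_def
proof (rule borel_measurable_lim_metric)
  fix k
  have "(\<lambda>x. fst x (max 0 ((real_of_int i + 1) / real (Suc k))))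
      \<in> borel_measurable (path_space \<Otimes>\<^sub>M (borel :: real measure))" for i
    by (rule measurable_compose[OF measurable_fst measurable_component_singleton]) simp
  then show "(\<lambda>x. fst x (max 0 (grid_above k (snd x)))) \<in> borel_measurable (path_space \<Otimes>\<^sub>M borel)"
    unfolding grid_above_def
    by (rule measurable_compose_countable[where g = "\<lambda>x. \<lfloor>real (Suc k) * snd x\<rfloor>"]) measurable
qed

text \<open>Independence makes the joint law a product, and Tonelli gives an iterated integral. The
  variable \<open>\<omega>'\<close> acts as an independent copy of the randomness, so
  \<open>X\<close> can be frozen while \<open>Y\<close> is averaged.\<close>

lemma (in prob_space) nn_integral_indep_var:
  assumes ind: "indep_var S X T Y" and f: "f \<in> borel_measurable (S \<Otimes>\<^sub>M T)"
  shows "(\<integral>\<^sup>+\<omega>. f (X \<omega>, Y \<omega>) \<partial>M) = (\<integral>\<^sup>+\<omega>. \<integral>\<^sup>+\<omega>'. f (X \<omega>, Y \<omega>') \<partial>M \<partial>M)"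
proof -
  have X: "X \<in> measurable M S" and Y: "Y \<in> measurable M T"
    and eq: "distr M S X \<Otimes>\<^sub>M distr M T Y = distr M (S \<Otimes>\<^sub>M T) (\<lambda>x. (X x, Y x))"
    using ind by (simp_all add: indep_var_distribution_eq)
  interpret Y: prob_space "distr M T Y" by (rule prob_space_distr[OF Y])
  have f': "f \<in> borel_measurable (distr M S X \<Otimes>\<^sub>M distr M T Y)"
    using f by (simp cong: measurable_cong_sets)
  have "(\<integral>\<^sup>+\<omega>. f (X \<omega>, Y \<omega>) \<partial>M) = integral\<^sup>N (distr M (S \<Otimes>\<^sub>M T) (\<lambda>x. (X x, Y x))) f"
    using X Y f by (subst nn_integral_distr) auto
  also have "\<dots> = (\<integral>\<^sup>+x. \<integral>\<^sup>+y. f (x, y) \<partial>distr M T Y \<partial>distr M S X)"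
    unfolding eq[symmetric] using f' by (simp add: Y.nn_integral_fst)
  also have "\<dots> = (\<integral>\<^sup>+\<omega>. \<integral>\<^sup>+y. f (X \<omega>, y) \<partial>distr M T Y \<partial>M)"
    using X Y.borel_measurable_nn_integral_fst[OF f'] by (subst nn_integral_distr) (auto cong: measurable_cong_sets)
  also have "\<dots> = (\<integral>\<^sup>+\<omega>. \<integral>\<^sup>+\<omega>'. f (X \<omega>, Y \<omega>') \<partial>M \<partial>M)"
  proof (intro nn_integral_cong)
    fix \<omega> assume "\<omega> \<in> space M"
    then have "(\<lambda>y. f (X \<omega>, y)) \<in> borel_measurable T"
      using X f by (auto dest!: measurable_space intro: measurable_Pair2)
    then show "(\<integral>\<^sup>+y. f (X \<omega>, y) \<partial>distr M T Y) = (\<integral>\<^sup>+\<omega>'. f (X \<omega>, Y \<omega>') \<partial>M)"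
      using Y by (subst nn_integral_distr) auto
  qed
  finally show ?thesis .
qed

subsection \<open>Increments of subordinators\<close>

lemma nonneg_if_increments_nonneg:
  fixes t :: "nat \<Rightarrow> real"
  assumes "0 \<le> t 0" "\<And>i. i < m \<Longrightarrow> t i \<le> t (Suc i)" "i \<le> m"
  shows "0 \<le> t i"
  using assms(3)
proof (induction i)
  case (Suc i)
  with assms(2)[of i] show ?case by simp
qed (use assms(1) in simp)

context prob_space
begin

text \<open>Independence factorises the integral, and stationarity replaces each increment by the
  value at its length. General functions \<open>g i\<close> instead of indicators are needed for
  time changes, where they arise as expectations.\<close>

lemma subordinator_increments:
  assumes X: "subordinator M X" and t: "0 \<le> t 0" "\<And>i. i < m \<Longrightarrow> t i \<le> t (Suc i)"
    and g: "\<And>i. i < m \<Longrightarrow> g i \<in> borel_measurable borel"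
  shows "(\<integral>\<^sup>+\<omega>. (\<Prod>i<m. g i (X (t (Suc i)) \<omega> - X (t i) \<omega>)) \<partial>M)
    = (\<Prod>i<m. \<integral>\<^sup>+\<omega>. g i (X (t (Suc i) - t i) \<omega>) \<partial>M)"
proof -
  have t0: "0 \<le> t i" if "i \<le> m" for i
    using t that by (rule nonneg_if_increments_nonneg)
  have meas: "X s \<in> borel_measurable M" if "0 \<le> s" for s
    using subordinatorD(1)[OF X] that .
  have ind: "indep_vars (\<lambda>_. borel) (\<lambda>i \<omega>. X (t (Suc i)) \<omega> - X (t i) \<omega>) {..<m}"
    using X t by (auto simp: subordinator_def)
  have "(\<integral>\<^sup>+\<omega>. (\<Prod>i<m. g i (X (t (Suc i)) \<omega> - X (t i) \<omega>)) \<partial>M)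
      = (\<Prod>i<m. \<integral>\<^sup>+\<omega>. g i (X (t (Suc i)) \<omega> - X (t i) \<omega>) \<partial>M)"
    using g by (intro indep_vars_nn_integral indep_vars_compose2[OF ind]) auto
  also have "\<dots> = (\<Prod>i<m. \<integral>\<^sup>+\<omega>. g i (X (t (Suc i) - t i) \<omega>) \<partial>M)"
  proof (intro prod.cong refl)
    fix i assume i: "i \<in> {..<m}"
    have inc: "(\<lambda>\<omega>. X (t (Suc i)) \<omega> - X (t i) \<omega>) \<in> borel_measurable M"
      using i t0[of i] t0[of "Suc i"] by (intro borel_measurable_diff meas) auto
    have "(\<integral>\<^sup>+\<omega>. g i (X (t (Suc i)) \<omega> - X (t i) \<omega>) \<partial>M)
        = (\<integral>\<^sup>+x. g i x \<partial>distr M borel (\<lambda>\<omega>. X (t (Suc i)) \<omega> - X (t i) \<omega>))"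
      using inc g i by (subst nn_integral_distr) auto
    also have "distr M borel (\<lambda>\<omega>. X (t (Suc i)) \<omega> - X (t i) \<omega>) = distr M borel (X (t (Suc i) - t i))"
    proof -
      have "distr M borel (\<lambda>\<omega>. X (t i + (t (Suc i) - t i)) \<omega> - X (t i) \<omega>)
          = distr M borel (X (t (Suc i) - t i))"
        using i t0[of i] t(2)[of i] by (intro subordinatorD(5)[OF X]) auto
      then show ?thesis by simp
    qed
    also have "(\<integral>\<^sup>+x. g i x \<partial>\<dots>) = (\<integral>\<^sup>+\<omega>. g i (X (t (Suc i) - t i) \<omega>) \<partial>M)"
      using i t(2)[of i] g meas by (subst nn_integral_distr) auto
    finally show "(\<integral>\<^sup>+\<omega>. g i (X (t (Suc i)) \<omega> - X (t i) \<omega>) \<partial>M) = \<dots>" .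
  qed
  finally show ?thesis .
qed

text \<open>Besides the path properties, one product formula for indicators carries both
  stationarity (a single increment) and independence (the general case).\<close>

lemma subordinatorI:
  assumes meas: "\<And>t. 0 \<le> t \<Longrightarrow> X t \<in> borel_measurable M"
    and zero: "\<And>\<omega>. \<omega> \<in> space M \<Longrightarrow> X 0 \<omega> = 0"
    and mono: "\<And>\<omega>. \<omega> \<in> space M \<Longrightarrow> mono_on {0..} (\<lambda>t. X t \<omega>)"
    and cont: "\<And>\<omega> t. \<omega> \<in> space M \<Longrightarrow> 0 \<le> t \<Longrightarrow> continuous (at_right t) (\<lambda>s. X s \<omega>)"
    and incr: "\<And>(m::nat) t A. 0 \<le> t 0 \<Longrightarrow> (\<And>i. i < m \<Longrightarrow> t i \<le> t (Suc i)) \<Longrightarrow>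
      (\<And>i. i < m \<Longrightarrow> A i \<in> sets borel) \<Longrightarrow>
      (\<integral>\<^sup>+\<omega>. (\<Prod>i<m. indicator (A i) (X (t (Suc i)) \<omega> - X (t i) \<omega>)) \<partial>M)
      = (\<Prod>i<m. \<integral>\<^sup>+\<omega>. indicator (A i) (X (t (Suc i) - t i) \<omega>) \<partial>M)"
  shows "subordinator M X"
proof -
  have single: "(\<integral>\<^sup>+\<omega>. indicator A (X s \<omega> - X r \<omega>) \<partial>M) = (\<integral>\<^sup>+\<omega>. indicator A (X (s - r) \<omega>) \<partial>M)"
    if "0 \<le> r" "r \<le> s" "A \<in> sets borel" for r s A
    \<comment> \<open>The case \<open>m = 1\<close>, with time \<open>r\<close> at index
      \<open>0\<close> and \<open>s\<close> afterwards.\<close>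
    using incr[of "\<lambda>i. if i = 0 then r else s" 1 "\<lambda>_. A"] that by simp
  have emeas: "(\<integral>\<^sup>+\<omega>. indicator A (Z \<omega>) \<partial>M) = emeasure M (Z -` A \<inter> space M)"
    if "Z \<in> borel_measurable M" "A \<in> sets borel" for Z :: "'a \<Rightarrow> real" and A
  proof -
    have "(\<integral>\<^sup>+\<omega>. indicator A (Z \<omega>) \<partial>M) = (\<integral>\<^sup>+\<omega>. indicator (Z -` A \<inter> space M) \<omega> \<partial>M)"
      by (intro nn_integral_cong) (auto split: split_indicator)
    then show ?thesis using that by (simp add: measurable_sets)
  qed
  have stationary: "distr M borel (\<lambda>\<omega>. X (t + h) \<omega> - X t \<omega>) = distr M borel (X h)"
    if "0 \<le> t" "0 \<le> h" for t h
  proof (rule measure_eqI)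
    fix A :: "real set" assume "A \<in> sets (distr M borel (\<lambda>\<omega>. X (t + h) \<omega> - X t \<omega>))"
    then have A: "A \<in> sets borel" by simp
    have m: "(\<lambda>\<omega>. X (t + h) \<omega> - X t \<omega>) \<in> borel_measurable M"
      using that by (intro borel_measurable_diff meas) auto
    show "emeasure (distr M borel (\<lambda>\<omega>. X (t + h) \<omega> - X t \<omega>)) A = emeasure (distr M borel (X h)) A"
      using single[of t "t + h" A] A that meas[of h]
      by (simp add: emeasure_distr m emeas)
  qed simp
  have indep: "indep_vars (\<lambda>_. borel) (\<lambda>i \<omega>. X (t (Suc i)) \<omega> - X (t i) \<omega>) {..<m}"
    if t: "0 \<le> t 0" "\<And>i. i < m \<Longrightarrow> t i \<le> t (Suc i)" for t and m :: nat
  \<comment> \<open>The empty family is split off because an intersection over no indices is the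
    universe of the type rather than \<open>space M\<close>.\<close>
  proof (cases "m = 0")
    case True
    then show ?thesis by (simp add: indep_vars_def indep_sets_def)
  next
    case False
    have t0: "0 \<le> t i" if "i \<le> m" for i
      using t that by (rule nonneg_if_increments_nonneg)
    define Z where "Z i \<omega> = X (t (Suc i)) \<omega> - X (t i) \<omega>" for i \<omega>
    have Z: "Z i \<in> borel_measurable M" if "i < m" for i
      unfolding Z_def using that t0[of i] t0[of "Suc i"] by (intro borel_measurable_diff meas) auto
    have "prob (\<Inter>j\<in>{..<m}. Z j -` A j \<inter> space M) = (\<Prod>j<m. prob (Z j -` A j \<inter> space M))"
      if A: "A \<in> {..<m} \<rightarrow> sets borel" for A
    proof -
      have A': "A i \<in> sets borel" if "i < m" for i using A that by auto
      have ev: "(\<Inter>j\<in>{..<m}. Z j -` A j \<inter> space M) \<in> events"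
        using False A' by (intro sets.finite_INT measurable_sets[OF Z]) auto
      have "emeasure M (\<Inter>j\<in>{..<m}. Z j -` A j \<inter> space M)
          = (\<integral>\<^sup>+\<omega>. indicator (\<Inter>j\<in>{..<m}. Z j -` A j \<inter> space M) \<omega> \<partial>M)"
        using ev by simp
      also have "\<dots> = (\<integral>\<^sup>+\<omega>. (\<Prod>i<m. indicator (A i) (Z i \<omega>)) \<partial>M)"
      proof (intro nn_integral_cong)
        fix \<omega> assume w: "\<omega> \<in> space M"
        show "indicator (\<Inter>j\<in>{..<m}. Z j -` A j \<inter> space M) \<omega> = (\<Prod>i<m. indicator (A i) (Z i \<omega>) :: ennreal)"
        proof (cases "\<forall>i<m. Z i \<omega> \<in> A i")
          case True
          then show ?thesis using w False by (auto simp: indicator_def)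
        next
          case F: False
          then obtain i where "i < m" "Z i \<omega> \<notin> A i" by auto
          moreover from this have "(\<Prod>i<m. indicator (A i) (Z i \<omega>) :: ennreal) = 0"
            by (intro prod_zero bexI[of _ i]) auto
          ultimately show ?thesis by (auto simp: indicator_def)
        qed
      qed
      also have "\<dots> = (\<Prod>i<m. \<integral>\<^sup>+\<omega>. indicator (A i) (X (t (Suc i) - t i) \<omega>) \<partial>M)"
        unfolding Z_def by (rule incr[of t m A, OF t A'])
      also have "\<dots> = (\<Prod>i<m. emeasure M (Z i -` A i \<inter> space M))"
      proof (intro prod.cong refl)
        fix i assume "i \<in> {..<m}"
        then show "(\<integral>\<^sup>+\<omega>. indicator (A i) (X (t (Suc i) - t i) \<omega>) \<partial>M) = emeasure M (Z i -` A i \<inter> space M)"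
          using single[of "t i" "t (Suc i)" "A i"] t0[of i] t(2)[of i] A' emeas[OF Z, of i "A i"]
          by (simp add: Z_def)
      qed
      finally have "ennreal (prob (\<Inter>j\<in>{..<m}. Z j -` A j \<inter> space M))
          = ennreal (\<Prod>j<m. prob (Z j -` A j \<inter> space M))"
        by (simp add: emeasure_eq_measure prod_ennreal)
      then show ?thesis
        by (subst (asm) ennreal_inj) (auto intro!: prod_nonneg)
    qed
    \<comment> \<open>The Borel sets are an intersection-stable generator of themselves, so the
      product formula over all \<open>m\<close> indices yields independence.\<close>
    then have "indep_vars (\<lambda>_. borel) Z {..<m}"
      using False Z
      by (subst indep_vars_finite[where E="\<lambda>_. sets borel"])
         (auto simp: Int_stable_def sets.sigma_sets_eq[of borel, simplified])
    then show ?thesis by (simp add: Z_def[abs_def])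
  qed
  show ?thesis
    unfolding subordinator_def
    by (intro conjI ballI allI impI meas zero mono cont stationary indep) auto
qed

end

subsection \<open>Time change by an independent subordinator\<close>

text \<open>Monotonicity sends points right of \<open>x\<close> into \<open>{f x..}\<close>. The
  half-line is closed because \<open>f\<close> may be constant to the right of \<open>x\<close>;
  adding the endpoint does not change the filter \<open>at_right (f x)\<close>.\<close>

lemma continuous_at_right_compose_mono:
  fixes f g :: "real \<Rightarrow> real"
  assumes f: "continuous (at_right x) f" and mono: "\<And>y. x \<le> y \<Longrightarrow> f x \<le> f y"
    and g: "continuous (at_right (f x)) g"
  shows "continuous (at_right x) (\<lambda>y. g (f y))"
proof -
  have "at (f x) within {f x..} = at_right (f x)"
    by (rule at_within_Ici_at_right)
  then have "continuous (at (f x) within {f x..}) g"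
    using g by simp
  then have "continuous (at (f x) within f ` {x<..}) g"
    by (rule continuous_within_subset) (use mono in auto)
  with f show ?thesis by (rule continuous_within_compose2)
qed

lemma subordinator_nonneg:
  assumes "subordinator M X" "\<omega> \<in> space M" "0 \<le> t"
  shows "0 \<le> X t \<omega>"
  using mono_onD[OF subordinatorD(3)[OF assms(1,2)], of 0 t] subordinatorD(2)[OF assms(1,2)] assms(3)
  by simp

lemma subordinator_mono:
  assumes "subordinator M X" "\<omega> \<in> space M" "0 \<le> s" "s \<le> t"
  shows "X s \<omega> \<le> X t \<omega>"
  using mono_onD[OF subordinatorD(3)[OF assms(1,2)], of s t] assms(3,4) by simp

lemma right_eval_subordinator:
  assumes "subordinator M X" "\<omega> \<in> space M" "0 \<le> s"
  shows "right_eval (path_of X \<omega>) s = X s \<omega>"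
  using subordinatorD(4)[OF assms] assms(3) by (rule right_eval_path_of)

lemma measurable_path_of:
  assumes "subordinator M X"
  shows "path_of X \<in> measurable M path_space"
  unfolding path_of_def using subordinatorD(1)[OF assms] by (intro measurable_restrict) auto

lemma measurable_at_random_time:
  assumes Y: "subordinator M Y" and Z: "Z \<in> borel_measurable M" "\<And>\<omega>. \<omega> \<in> space M \<Longrightarrow> 0 \<le> Z \<omega>"
  shows "(\<lambda>\<omega>. Y (Z \<omega>) \<omega>) \<in> borel_measurable M"
proof -
  have "(\<lambda>\<omega>. (path_of Y \<omega>, Z \<omega>)) \<in> measurable M (path_space \<Otimes>\<^sub>M borel)"
    using Z measurable_path_of[OF Y] by simp
  from measurable_compose[OF this measurable_right_eval]
  have "(\<lambda>\<omega>. right_eval (path_of Y \<omega>) (Z \<omega>)) \<in> borel_measurable M" by simp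
  then show ?thesis
    by (rule measurable_cong[THEN iffD1, rotated]) (use right_eval_subordinator[OF Y] Z in auto)
qed

lemma measurable_right_eval_component:
  assumes "0 \<le> t"
  shows "(\<lambda>p. right_eval (snd p) (fst p t)) \<in> borel_measurable (path_space \<Otimes>\<^sub>M path_space)"
proof -
  have "(\<lambda>p. fst p t) \<in> borel_measurable (path_space \<Otimes>\<^sub>M path_space)"
    by (rule measurable_compose[OF measurable_fst measurable_component_singleton]) (use assms in simp)
  then have "(\<lambda>p. (snd p, fst p t)) \<in> measurable (path_space \<Otimes>\<^sub>M path_space) (path_space \<Otimes>\<^sub>M borel)"
    by simp
  from measurable_compose[OF this measurable_right_eval] show ?thesis by simp
qed

context prob_space
begin

text \<open>Written through \<open>right_eval\<close>, the integrand is a measurable function of the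
  two paths, so the path of \<open>X\<close> can be frozen and that of \<open>Y\<close> averaged
  separately.\<close>

lemma nn_integral_time_change:
  assumes X: "subordinator M X" and Y: "subordinator M Y"
    and ind: "indep_var path_space (path_of X) path_space (path_of Y)"
    and s: "0 \<le> s" and g: "g \<in> borel_measurable borel"
  shows "(\<integral>\<^sup>+\<omega>. g (Y (X s \<omega>) \<omega>) \<partial>M) = (\<integral>\<^sup>+\<omega>. \<integral>\<^sup>+\<omega>'. g (Y (X s \<omega>) \<omega>') \<partial>M \<partial>M)"
proof -
  define f where "f p = g (right_eval (snd p) (fst p s))" for p :: "(real \<Rightarrow> real) \<times> (real \<Rightarrow> real)"
  have f: "f \<in> borel_measurable (path_space \<Otimes>\<^sub>M path_space)"
    unfolding f_def by (rule measurable_compose[OF measurable_right_eval_component g]) (rule s)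
  have eq: "f (path_of X \<omega>, path_of Y \<omega>') = g (Y (X s \<omega>) \<omega>')"
    if "\<omega> \<in> space M" "\<omega>' \<in> space M" for \<omega> \<omega>'
    unfolding f_def using right_eval_subordinator[OF Y that(2) subordinator_nonneg[OF X that(1) s]] s
    by simp
  show ?thesis
    using nn_integral_indep_var[OF ind f] by (simp add: eq cong: nn_integral_cong)
qed

text \<open>Decouple, factorise twice, recouple: with the path of \<open>X\<close> frozen the
  increments of \<open>Y\<close> factorise, the resulting functions of the increments of
  \<open>X\<close> factorise in turn, and each factor is read back as a time change at a single
  time.\<close>

lemma time_change_increments:
  assumes X: "subordinator M X" and Y: "subordinator M Y"
    and ind: "indep_var path_space (path_of X) path_space (path_of Y)"
    and t: "0 \<le> t 0" "\<And>i. i < m \<Longrightarrow> t i \<le> t (Suc i)"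
    and g: "\<And>i. i < m \<Longrightarrow> g i \<in> borel_measurable borel"
  shows "(\<integral>\<^sup>+\<omega>. (\<Prod>i<m. g i (Y (X (t (Suc i)) \<omega>) \<omega> - Y (X (t i) \<omega>) \<omega>)) \<partial>M)
    = (\<Prod>i<m. \<integral>\<^sup>+\<omega>. g i (Y (X (t (Suc i) - t i) \<omega>) \<omega>) \<partial>M)"
proof -
  have t0: "0 \<le> t i" if "i \<le> m" for i
    using t that by (rule nonneg_if_increments_nonneg)
  \<comment> \<open>Using \<open>right_eval\<close> instead of \<open>Y s\<close> makes
    \<open>h i\<close> Borel on the whole line; it is identified with the expectation of
    \<open>g i (Y s)\<close> for \<open>s \<ge> 0\<close> only.\<close>
  define h where "h i s = (\<integral>\<^sup>+\<omega>. g i (right_eval (path_of Y \<omega>) s) \<partial>M)" for i s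
  have h: "h i \<in> borel_measurable borel" if "i < m" for i
  proof -
    have "(\<lambda>x. (path_of Y (snd x), fst x)) \<in> measurable (borel \<Otimes>\<^sub>M M) (path_space \<Otimes>\<^sub>M borel)"
      using measurable_path_of[OF Y] by simp
    from measurable_compose[OF measurable_compose[OF this measurable_right_eval] g[OF that]]
    have "(\<lambda>x. g i (right_eval (path_of Y (snd x)) (fst x))) \<in> borel_measurable (borel \<Otimes>\<^sub>M M)"
      by simp
    from borel_measurable_nn_integral_fst[OF this] show ?thesis
      unfolding h_def by simp
  qed
  have h_eq: "h i s = (\<integral>\<^sup>+\<omega>. g i (Y s \<omega>) \<partial>M)" if "0 \<le> s" for i s
    unfolding h_def by (intro nn_integral_cong) (simp add: right_eval_subordinator[OF Y _ that])
  define f where "f p = (\<Prod>i<m. g i (right_eval (snd p) (fst p (t (Suc i))) - right_eval (snd p) (fst p (t i))))"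
    for p :: "(real \<Rightarrow> real) \<times> (real \<Rightarrow> real)"
  have f: "f \<in> borel_measurable (path_space \<Otimes>\<^sub>M path_space)"
    unfolding f_def
  proof (rule borel_measurable_prod_ennreal)
    fix i assume "i \<in> {..<m}"
    then show "(\<lambda>p. g i (right_eval (snd p) (fst p (t (Suc i))) - right_eval (snd p) (fst p (t i))))
        \<in> borel_measurable (path_space \<Otimes>\<^sub>M path_space)"
      using t0[of i] t0[of "Suc i"]
      by (intro measurable_compose[OF _ g] borel_measurable_diff measurable_right_eval_component) auto
  qed
  have eq: "f (path_of X \<omega>, path_of Y \<omega>')
      = (\<Prod>i<m. g i (Y (X (t (Suc i)) \<omega>) \<omega>' - Y (X (t i) \<omega>) \<omega>'))"
    if "\<omega> \<in> space M" "\<omega>' \<in> space M" for \<omega> \<omega>'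
    unfolding f_def
    by (intro prod.cong refl)
       (simp add: right_eval_subordinator[OF Y that(2)] subordinator_nonneg[OF X that(1)] t0)
  have "(\<integral>\<^sup>+\<omega>. (\<Prod>i<m. g i (Y (X (t (Suc i)) \<omega>) \<omega> - Y (X (t i) \<omega>) \<omega>)) \<partial>M)
      = (\<integral>\<^sup>+\<omega>. \<integral>\<^sup>+\<omega>'. (\<Prod>i<m. g i (Y (X (t (Suc i)) \<omega>) \<omega>' - Y (X (t i) \<omega>) \<omega>')) \<partial>M \<partial>M)"
    using nn_integral_indep_var[OF ind f] by (simp add: eq cong: nn_integral_cong)
  also have "\<dots> = (\<integral>\<^sup>+\<omega>. (\<Prod>i<m. h i (X (t (Suc i)) \<omega> - X (t i) \<omega>)) \<partial>M)"
  proof (intro nn_integral_cong)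
    fix \<omega> assume w: "\<omega> \<in> space M"
    have "(\<integral>\<^sup>+\<omega>'. (\<Prod>i<m. g i (Y (X (t (Suc i)) \<omega>) \<omega>' - Y (X (t i) \<omega>) \<omega>')) \<partial>M)
        = (\<Prod>i<m. \<integral>\<^sup>+\<omega>'. g i (Y (X (t (Suc i)) \<omega> - X (t i) \<omega>) \<omega>') \<partial>M)"
      \<comment> \<open>For fixed \<open>\<omega>\<close> the times \<open>X (t i) \<omega>\<close>
        are nonnegative and ordered, hence an admissible deterministic partition for
        \<open>Y\<close>.\<close>
      using subordinator_nonneg[OF X w t(1)] subordinator_mono[OF X w] t t0 g
      by (intro subordinator_increments[OF Y, of "\<lambda>i. X (t i) \<omega>"]) auto
    also have "\<dots> = (\<Prod>i<m. h i (X (t (Suc i)) \<omega> - X (t i) \<omega>))"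
      using subordinator_mono[OF X w] t t0 by (intro prod.cong refl h_eq[symmetric]) auto
    finally show "(\<integral>\<^sup>+\<omega>'. (\<Prod>i<m. g i (Y (X (t (Suc i)) \<omega>) \<omega>' - Y (X (t i) \<omega>) \<omega>')) \<partial>M) = \<dots>" .
  qed
  also have "\<dots> = (\<Prod>i<m. \<integral>\<^sup>+\<omega>. h i (X (t (Suc i) - t i) \<omega>) \<partial>M)"
    using t h by (rule subordinator_increments[OF X, of t m h])
  also have "\<dots> = (\<Prod>i<m. \<integral>\<^sup>+\<omega>. g i (Y (X (t (Suc i) - t i) \<omega>) \<omega>) \<partial>M)"
  proof (intro prod.cong refl)
    fix i assume "i \<in> {..<m}"
    then have i: "i < m" "0 \<le> t (Suc i) - t i" using t(2)[of i] by auto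
    have "(\<integral>\<^sup>+\<omega>. h i (X (t (Suc i) - t i) \<omega>) \<partial>M)
        = (\<integral>\<^sup>+\<omega>. \<integral>\<^sup>+\<omega>'. g i (Y (X (t (Suc i) - t i) \<omega>) \<omega>') \<partial>M \<partial>M)"
      by (intro nn_integral_cong h_eq subordinator_nonneg[OF X] i)
    also have "\<dots> = (\<integral>\<^sup>+\<omega>. g i (Y (X (t (Suc i) - t i) \<omega>) \<omega>) \<partial>M)"
      by (rule nn_integral_time_change[symmetric, OF X Y ind i(2) g[OF i(1)]])
    finally show "(\<integral>\<^sup>+\<omega>. h i (X (t (Suc i) - t i) \<omega>) \<partial>M) = \<dots>" .
  qed
  finally show ?thesis .
qed

lemma subordinator_time_change:
  assumes X: "subordinator M X" and Y: "subordinator M Y"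
    and ind: "indep_var path_space (path_of X) path_space (path_of Y)"
  shows "subordinator M (\<lambda>t \<omega>. Y (X t \<omega>) \<omega>)"
proof (rule subordinatorI)
  show "(\<lambda>\<omega>. Y (X t \<omega>) \<omega>) \<in> borel_measurable M" if "0 \<le> t" for t
    using subordinatorD(1)[OF X that] subordinator_nonneg[OF X _ that] by (rule measurable_at_random_time[OF Y])
  show "Y (X 0 \<omega>) \<omega> = 0" if "\<omega> \<in> space M" for \<omega>
    using subordinatorD(2)[OF X that] subordinatorD(2)[OF Y that] by simp
  show "mono_on {0..} (\<lambda>t. Y (X t \<omega>) \<omega>)" if w: "\<omega> \<in> space M" for \<omega>
    by (intro mono_onI subordinator_mono[OF Y w] subordinator_mono[OF X w] subordinator_nonneg[OF X w]) auto
  show "continuous (at_right t) (\<lambda>s. Y (X s \<omega>) \<omega>)" if w: "\<omega> \<in> space M" and t: "0 \<le> t" for \<omega> t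
  proof (rule continuous_at_right_compose_mono[where f = "\<lambda>s. X s \<omega>" and g = "\<lambda>s. Y s \<omega>"])
    show "continuous (at_right t) (\<lambda>s. X s \<omega>)" by (rule subordinatorD(4)[OF X w t])
    show "X t \<omega> \<le> X y \<omega>" if "t \<le> y" for y by (rule subordinator_mono[OF X w t that])
    show "continuous (at_right (X t \<omega>)) (\<lambda>s. Y s \<omega>)"
      by (rule subordinatorD(4)[OF Y w subordinator_nonneg[OF X w t]])
  qed
next
  fix m :: nat and t :: "nat \<Rightarrow> real" and A :: "nat \<Rightarrow> real set"
  assume t: "0 \<le> t 0" "\<And>i. i < m \<Longrightarrow> t i \<le> t (Suc i)" and A: "\<And>i. i < m \<Longrightarrow> A i \<in> sets borel"
  show "(\<integral>\<^sup>+\<omega>. (\<Prod>i<m. indicator (A i) (Y (X (t (Suc i)) \<omega>) \<omega> - Y (X (t i) \<omega>) \<omega>)) \<partial>M)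
      = (\<Prod>i<m. \<integral>\<^sup>+\<omega>. indicator (A i) (Y (X (t (Suc i) - t i) \<omega>) \<omega>) \<partial>M)"
    using A by (intro time_change_increments[OF X Y ind t, where g = "\<lambda>i. indicator (A i)"]) auto
qed

section \<open>Laplace exponents under time change\<close>

lemma has_laplace_exponent_iff_nn_integral:
  assumes X: "subordinator M X"
  shows "has_laplace_exponent M X f \<longleftrightarrow>
    (\<forall>t\<ge>0. \<forall>u\<ge>0. (\<integral>\<^sup>+\<omega>. ennreal (exp (- u * X t \<omega>)) \<partial>M) = ennreal (exp (- t * f u)))"
proof -
  have "(\<integral>\<omega>. exp (- u * X t \<omega>) \<partial>M) = exp (- t * f u) \<longleftrightarrow>
      (\<integral>\<^sup>+\<omega>. ennreal (exp (- u * X t \<omega>)) \<partial>M) = ennreal (exp (- t * f u))"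
    if tu: "0 \<le> t" "0 \<le> u" for t u
  proof -
    have meas: "(\<lambda>\<omega>. exp (- u * X t \<omega>)) \<in> borel_measurable M"
      using subordinatorD(1)[OF X tu(1)] by simp
    \<comment> \<open>Since \<open>X t \<omega>\<close> and \<open>u\<close> are nonnegative, the
      integrand stays in \<open>[0, 1]\<close>, so both integrals agree; the nonnegative one is the
      form suited to Tonelli.\<close>
    have "integrable M (\<lambda>\<omega>. exp (- u * X t \<omega>))"
      using subordinator_nonneg[OF X _ tu(1)] tu(2)
      by (intro integrable_const_bound[where B=1] meas AE_I2) (auto simp: mult_nonneg_nonneg)
    then have "(\<integral>\<^sup>+\<omega>. ennreal (exp (- u * X t \<omega>)) \<partial>M) = ennreal (\<integral>\<omega>. exp (- u * X t \<omega>) \<partial>M)"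
      by (intro nn_integral_eq_integral) auto
    then show ?thesis
      by (simp add: ennreal_inj integral_nonneg)
  qed
  then show ?thesis unfolding has_laplace_exponent_def by blast
qed

text \<open>Averaging \<open>Y\<close> at a frozen time \<open>s\<close> gives
  \<open>exp (- s * g u)\<close>. Taking \<open>s = X t\<close> leaves the transform of
  \<open>X t\<close> at \<open>g u\<close>, which has to be nonnegative for \<open>f\<close> to
  describe it.\<close>

lemma has_laplace_exponent_time_change:
  assumes X: "subordinator M X" and Y: "subordinator M Y"
    and ind: "indep_var path_space (path_of X) path_space (path_of Y)"
    and fX: "has_laplace_exponent M X f" and fY: "has_laplace_exponent M Y g"
    and g: "\<And>u. 0 \<le> u \<Longrightarrow> 0 \<le> g u"
  shows "has_laplace_exponent M (\<lambda>t \<omega>. Y (X t \<omega>) \<omega>) (\<lambda>u. f (g u))"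
  unfolding has_laplace_exponent_iff_nn_integral[OF subordinator_time_change[OF X Y ind]]
proof (intro allI impI)
  fix t u :: real assume t: "0 \<le> t" and u: "0 \<le> u"
  have "(\<integral>\<^sup>+\<omega>. ennreal (exp (- u * Y (X t \<omega>) \<omega>)) \<partial>M)
      = (\<integral>\<^sup>+\<omega>. \<integral>\<^sup>+\<omega>'. ennreal (exp (- u * Y (X t \<omega>) \<omega>')) \<partial>M \<partial>M)"
    by (rule nn_integral_time_change[OF X Y ind t, where g = "\<lambda>x. ennreal (exp (- u * x))"]) simp
  also have "\<dots> = (\<integral>\<^sup>+\<omega>. ennreal (exp (- g u * X t \<omega>)) \<partial>M)"
    using fY subordinator_nonneg[OF X _ t] u
    by (intro nn_integral_cong) (simp add: has_laplace_exponent_iff_nn_integral[OF Y] mult.commute)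
  also have "\<dots> = ennreal (exp (- t * f (g u)))"
    using fX t g[OF u] by (simp add: has_laplace_exponent_iff_nn_integral[OF X])
  finally show "(\<integral>\<^sup>+\<omega>. ennreal (exp (- u * Y (X t \<omega>) \<omega>)) \<partial>M) = \<dots>" .
qed

section \<open>Drift, the deterministic clock, and Poisson processes\<close>

lemma subordinator_drift:
  assumes X: "subordinator M X" and c: "0 \<le> c"
  shows "subordinator M (\<lambda>t \<omega>. c * t + X t \<omega>)"
proof (rule subordinatorI)
  show "(\<lambda>\<omega>. c * t + X t \<omega>) \<in> borel_measurable M" if "0 \<le> t" for t
    using subordinatorD(1)[OF X that] by simp
  show "c * 0 + X 0 \<omega> = 0" if "\<omega> \<in> space M" for \<omega>
    using subordinatorD(2)[OF X that] by simp
  show "mono_on {0..} (\<lambda>t. c * t + X t \<omega>)" if w: "\<omega> \<in> space M" for \<omega>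
    using c by (intro mono_onI add_mono mult_left_mono subordinator_mono[OF X w]) auto
  show "continuous (at_right t) (\<lambda>s. c * s + X s \<omega>)" if w: "\<omega> \<in> space M" and t: "0 \<le> t" for \<omega> t
    using subordinatorD(4)[OF X w t] by (intro continuous_intros)
next
  fix m :: nat and t :: "nat \<Rightarrow> real" and A :: "nat \<Rightarrow> real set"
  assume t: "0 \<le> t 0" "\<And>i. i < m \<Longrightarrow> t i \<le> t (Suc i)" and A: "\<And>i. i < m \<Longrightarrow> A i \<in> sets borel"
  \<comment> \<open>The drift over the \<open>i\<close>-th interval is a constant, absorbed by
    translating the test set.\<close>
  define g where "g i x = (indicator (A i) (c * (t (Suc i) - t i) + x) :: ennreal)" for i x
  have g: "g i \<in> borel_measurable borel" if "i < m" for i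
    unfolding g_def using A[OF that] by measurable
  show "(\<integral>\<^sup>+\<omega>. (\<Prod>i<m. indicator (A i) (c * t (Suc i) + X (t (Suc i)) \<omega> - (c * t i + X (t i) \<omega>))) \<partial>M)
      = (\<Prod>i<m. \<integral>\<^sup>+\<omega>. indicator (A i) (c * (t (Suc i) - t i) + X (t (Suc i) - t i) \<omega>) \<partial>M)"
    using subordinator_increments[OF X t(1) t(2), of m g] g unfolding g_def
    by (simp add: algebra_simps)
qed

lemma has_laplace_exponent_drift:
  assumes "has_laplace_exponent M X f"
  shows "has_laplace_exponent M (\<lambda>t \<omega>. c * t + X t \<omega>) (\<lambda>u. c * u + f u)"
  unfolding has_laplace_exponent_def
proof (intro allI impI)
  fix t u :: real assume "0 \<le> t" "0 \<le> u"
  then have *: "(\<integral>\<omega>. exp (- u * X t \<omega>) \<partial>M) = exp (- t * f u)"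
    using assms by (simp add: has_laplace_exponent_def)
  have "(\<integral>\<omega>. exp (- u * (c * t + X t \<omega>)) \<partial>M) = (\<integral>\<omega>. exp (- u * (c * t)) * exp (- u * X t \<omega>) \<partial>M)"
    by (simp add: exp_add[symmetric] algebra_simps)
  also have "\<dots> = exp (- u * (c * t)) * exp (- t * f u)"
    using * by simp
  also have "\<dots> = exp (- t * (c * u + f u))"
    by (simp add: exp_add[symmetric] algebra_simps)
  finally show "(\<integral>\<omega>. exp (- u * (c * t + X t \<omega>)) \<partial>M) = exp (- t * (c * u + f u))" .
qed

lemma subordinator_identity: "subordinator M (\<lambda>t \<omega>. t)"
proof (rule subordinatorI)
  fix m :: nat and t :: "nat \<Rightarrow> real" and A :: "nat \<Rightarrow> real set"
  show "(\<integral>\<^sup>+\<omega>. (\<Prod>i<m. indicator (A i) (t (Suc i) - t i)) \<partial>M)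
      = (\<Prod>i<m. \<integral>\<^sup>+\<omega>. indicator (A i) (t (Suc i) - t i) \<partial>M)"
    by (simp add: emeasure_space_1)
qed (auto intro: mono_onI)

lemma has_laplace_exponent_identity: "has_laplace_exponent M (\<lambda>t \<omega>. t) (\<lambda>u. u)"
  by (simp add: has_laplace_exponent_def prob_space mult.commute)

text \<open>This is the Poisson generating function at \<open>exp (- u)\<close>: with
  \<open>r = l * t\<close>, the exponential series sums to
  \<open>exp (- r) * exp (r * exp (- u))\<close>.\<close>

lemma has_laplace_exponent_poisson:
  assumes N: "poisson_process M l N" and l: "0 < l"
  shows "has_laplace_exponent M (\<lambda>t \<omega>. real (N t \<omega>)) (\<lambda>u. l * (1 - exp (- u)))"
  unfolding has_laplace_exponent_def
proof (intro allI impI)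
  fix t u :: real assume t: "0 \<le> t" and u: "0 \<le> u"
  have sub: "subordinator M (\<lambda>t \<omega>. real (N t \<omega>))" using N by (simp add: poisson_process_def)
  show "(\<integral>\<omega>. exp (- u * real (N t \<omega>)) \<partial>M) = exp (- t * (l * (1 - exp (- u))))"
  \<comment> \<open>Time \<open>0\<close> is separate: the law is prescribed only for
    \<open>t > 0\<close>, whereas the paths start at \<open>0\<close>.\<close>
  proof (cases "t = 0")
    case True
    have "(\<integral>\<omega>. exp (- u * real (N t \<omega>)) \<partial>M) = (\<integral>\<omega>. 1 \<partial>M)"
      using subordinatorD(2)[OF sub] True by (intro Bochner_Integration.integral_cong) auto
    then show ?thesis using True by (simp add: prob_space)
  next
    case False
    with t have t: "0 < t" by simp
    define r where "r = l * t"
    have r: "0 < r" using t l by (simp add: r_def)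
    \<comment> \<open>Measurability is given for \<open>real (N t \<omega>)\<close>; composing with
      the floor recovers it for the integer-valued map.\<close>
    have "(\<lambda>x::real. nat \<lfloor>x\<rfloor>) \<in> measurable borel (count_space UNIV)" by measurable
    from measurable_compose[OF subordinatorD(1)[OF sub less_imp_le[OF t]] this]
    have "(\<lambda>\<omega>. nat \<lfloor>real (N t \<omega>)\<rfloor>) \<in> measurable M (count_space UNIV)" .
    then have meas: "N t \<in> measurable M (count_space UNIV)" by simp
    have "(\<integral>\<omega>. exp (- u * real (N t \<omega>)) \<partial>M) = (\<integral>n. exp (- u * real n) \<partial>distr M (count_space UNIV) (N t))"
      using meas by (subst integral_distr) auto
    also have "\<dots> = (\<integral>n. exp (- u * real n) \<partial>measure_pmf (poisson_pmf r))"
      using N t by (simp add: poisson_process_def r_def)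
    also have "\<dots> = (\<integral>n. pmf (poisson_pmf r) n * exp (- u * real n) \<partial>count_space UNIV)"
      by (subst measure_pmf_eq_density, subst integral_real_density) auto
    also have "\<dots> = (\<integral>n. exp (- r) * ((r * exp (- u)) ^ n / fact n) \<partial>count_space UNIV)"
      using r by (intro Bochner_Integration.integral_cong)
        (simp_all add: power_mult_distrib exp_of_nat_mult[symmetric] mult_ac)
    also have "\<dots> = exp (- r) * exp (r * exp (- u))"
    proof -
      have sums: "(\<lambda>n. exp (- r) * ((r * exp (- u)) ^ n / fact n)) sums (exp (- r) * exp (r * exp (- u)))"
        by (intro sums_mult) (use exp_converges[of "r * exp (- u)"] in \<open>simp add: divide_inverse mult.commute\<close>)
      then have "integrable (count_space UNIV) (\<lambda>n. exp (- r) * ((r * exp (- u)) ^ n / fact n))"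
        using r by (subst integrable_count_space_nat_iff) (simp add: sums_iff)
      from sums_integral_count_space_nat[OF this] sums show ?thesis by (simp add: sums_iff)
    qed
    also have "\<dots> = exp (- t * (l * (1 - exp (- u))))"
      by (simp add: exp_add[symmetric] r_def algebra_simps)
    finally show ?thesis .
  qed
qed

end

subsection \<open>The recursion for the Laplace exponents\<close>

lemma gamma_sum_0 [simp]: "gamma_sum l b 0 = 0"
  by (simp add: gamma_sum_def)

lemma gamma_sum_Suc: "gamma_sum l b (Suc m) = l * gamma_sum l b m + b ^ m"
proof -
  have "(\<Sum>j=1..m. l ^ (Suc m - j) * b ^ (j - 1)) = (\<Sum>j=1..m. l * (l ^ (m - j) * b ^ (j - 1)))"
    by (intro sum.cong refl) (simp add: Suc_diff_le)
  then show ?thesis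
    by (simp add: gamma_sum_def sum_distrib_left)
qed

text \<open>Peeling the sum at its other end exposes the gap \<open>l ^ m\<close> between
  \<open>gamma_sum l b (Suc m)\<close> and \<open>b * gamma_sum l b m\<close>, which gives the
  monotonicity of the ratios below.\<close>

lemma gamma_sum_Suc': "gamma_sum l b (Suc m) = b * gamma_sum l b m + l ^ m"
proof (induction m)
  case (Suc m)
  have "gamma_sum l b (Suc (Suc m)) = l * (b * gamma_sum l b m + l ^ m) + b ^ Suc m"
    by (subst gamma_sum_Suc) (simp only: Suc)
  also have "\<dots> = b * gamma_sum l b (Suc m) + l ^ Suc m"
    by (simp add: gamma_sum_Suc algebra_simps)
  finally show ?case .
qed (simp add: gamma_sum_Suc)

lemma gamma_sum_one: "gamma_sum 1 1 m = real m"
  by (induction m) (simp_all add: gamma_sum_Suc)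

lemma gamma_sum_closed_form:
  assumes "l \<noteq> b"
  shows "gamma_sum l b m = (l ^ m - b ^ m) * inverse (l - b)"
proof (induction m)
  case (Suc m)
  have "l - b \<noteq> 0" using assms by simp
  then show ?case by (simp add: gamma_sum_Suc Suc field_simps)
qed simp

lemma gamma_sum_nonneg:
  assumes "0 < b" "0 < l"
  shows "0 \<le> gamma_sum l b m"
  using assms by (auto simp: gamma_sum_def intro!: sum_nonneg)

lemma gamma_sum_pos:
  assumes "0 < b" "0 < l" "0 < m"
  shows "0 < gamma_sum l b m"
proof -
  obtain k where "m = Suc k" using assms(3) by (cases m) auto
  then show ?thesis using assms gamma_sum_nonneg[of b l k] by (simp add: gamma_sum_Suc add_nonneg_pos)
qed

text \<open>After cross-multiplication the two sides differ by \<open>b ^ m * l ^ m\<close>, by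
  \<open>gamma_sum_Suc'\<close>.\<close>

lemma gamma_sum_ratio_antimono:
  assumes "0 < b" "0 < l" "0 < m"
  shows "b ^ Suc m / gamma_sum l b (Suc m) \<le> b ^ m / gamma_sum l b m"
  using assms gamma_sum_pos[OF assms] gamma_sum_pos[OF assms(1,2), of "Suc m"]
  by (simp add: divide_le_eq le_divide_eq gamma_sum_Suc' field_simps)

section \<open>The closed form of the exponent and its recursion\<close>

definition iterated_exponent :: "(nat \<Rightarrow> real) \<Rightarrow> real \<Rightarrow> real \<Rightarrow> nat \<Rightarrow> real \<Rightarrow> real" where
  "iterated_exponent a b l n u =
     (\<Sum>k<n. (a (n - k) - a (n - k - 1)) * ln (1 + u * (gamma_sum l b (k + 1) / b ^ (k + 1))))
     + l ^ n * (u / (b ^ n + u * gamma_sum l b n))"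

text \<open>The substitution raises every index of \<open>gamma_sum\<close> by one at the cost of a
  common denominator \<open>1 + u / b\<close>; the logarithms of these denominators collect to a
  multiple of \<open>a n\<close>.\<close>

lemma iterated_exponent_Suc:
  assumes b: "0 < b" and l: "0 < l" and u: "0 \<le> u" and a0: "a 0 = 0"
  shows "iterated_exponent a b l (Suc n) u
    = a (Suc n) * ln (1 + u / b) + iterated_exponent a b l n (l * u / (b + u))"
proof -
  \<comment> \<open>Dividing by \<open>b ^ m\<close> makes the recursion affine:
    \<open>D (Suc m) = (1 + l * D m) / b\<close> with \<open>D 0 = 0\<close>.\<close>
  define D where "D m = gamma_sum l b m / b ^ m" for m
  have D: "D (Suc m) = (1 + l * D m) / b" for m
    using b by (simp add: D_def gamma_sum_Suc field_simps)
  have D0: "0 \<le> D m" for m using gamma_sum_nonneg[OF b l] b by (simp add: D_def)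
  define v where "v = l * u / (b + u)"
  have v: "0 \<le> v" using u b l by (simp add: v_def)
  have pos: "0 < 1 + u * D m" for m using u D0[of m] by (simp add: add_pos_nonneg)
  have posb: "0 < 1 + u / b" using u b by (simp add: add_pos_nonneg)
  have ratio: "1 + v * D m = (1 + u * D (Suc m)) / (1 + u / b)" for m
  proof -
    have bu: "b + u \<noteq> 0" using u b by linarith
    have "1 + u * D (Suc m) = (b + u + l * u * D m) / b" "1 + u / b = (b + u) / b"
      using b by (simp_all add: D field_simps)
    moreover have "1 + v * D m = (b + u + l * u * D m) / (b + u)"
      using bu by (simp add: v_def field_simps)
    ultimately show ?thesis using b by simp
  qed
  have ln_v: "ln (1 + v * D m) = ln (1 + u * D (Suc m)) - ln (1 + u / b)" for m
    unfolding ratio by (rule ln_divide_pos[OF pos posb])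
  \<comment> \<open>Reversing the order telescopes the coefficients to \<open>a n - a 0\<close>;
    this is where \<open>a 0 = 0\<close> enters.\<close>
  have tele: "(\<Sum>k<n. a (n - k) - a (n - k - 1)) = a n"
  proof -
    have "(\<Sum>k<n. a (n - k) - a (n - k - 1)) = (\<Sum>k<n. a (Suc k) - a k)"
      by (subst sum.nat_diff_reindex[symmetric]) (intro sum.cong refl, simp add: Suc_diff_Suc)
    then show ?thesis by (simp add: sum_lessThan_telescope a0)
  qed
  \<comment> \<open>Numerator and denominator on the right both carry the factor
    \<open>1 / (b + u)\<close>, which cancels.\<close>
  have last: "l ^ Suc n * (u / (b ^ Suc n + u * gamma_sum l b (Suc n)))
      = l ^ n * (v / (b ^ n + v * gamma_sum l b n))"
  proof -
    have bu: "0 < b + u" using b u by simp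
    have "b ^ n + v * gamma_sum l b n = (b ^ Suc n + u * gamma_sum l b (Suc n)) / (b + u)"
      using bu by (simp add: v_def gamma_sum_Suc field_simps)
    then have "v / (b ^ n + v * gamma_sum l b n) = l * (u / (b ^ Suc n + u * gamma_sum l b (Suc n)))"
      using bu by (simp add: v_def)
    then show ?thesis by simp
  qed
  have "iterated_exponent a b l (Suc n) u
      = (\<Sum>k<Suc n. (a (Suc n - k) - a (Suc n - k - 1)) * ln (1 + u * D (Suc k)))
        + l ^ Suc n * (u / (b ^ Suc n + u * gamma_sum l b (Suc n)))"
    by (simp only: iterated_exponent_def D_def Suc_eq_plus1)
  \<comment> \<open>The term \<open>k = 0\<close> is the new logarithm, with coefficient
    \<open>a (Suc n) - a n\<close>; the missing \<open>a n\<close> comes back from the denominators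
    in the next step.\<close>
  also have "(\<Sum>k<Suc n. (a (Suc n - k) - a (Suc n - k - 1)) * ln (1 + u * D (Suc k)))
      = (a (Suc n) - a n) * ln (1 + u / b)
        + (\<Sum>k<n. (a (n - k) - a (n - k - 1)) * ln (1 + u * D (Suc (Suc k))))"
    by (subst sum.lessThan_Suc_shift) (simp add: D[of 0] D_def[of 0])
  also have "(\<Sum>k<n. (a (n - k) - a (n - k - 1)) * ln (1 + u * D (Suc (Suc k))))
      = (\<Sum>k<n. (a (n - k) - a (n - k - 1)) * ln (1 + v * D (Suc k))) + a n * ln (1 + u / b)"
  proof -
    have "(\<Sum>k<n. (a (n - k) - a (n - k - 1)) * ln (1 + u * D (Suc (Suc k))))
        = (\<Sum>k<n. (a (n - k) - a (n - k - 1)) * ln (1 + v * D (Suc k))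
            + (a (n - k) - a (n - k - 1)) * ln (1 + u / b))"
      by (intro sum.cong refl) (simp add: ln_v algebra_simps)
    then show ?thesis by (simp add: sum.distrib sum_distrib_right[symmetric] tele[simplified])
  qed
  finally have lhs: "iterated_exponent a b l (Suc n) u
      = (a (Suc n) - a n) * ln (1 + u / b)
        + ((\<Sum>k<n. (a (n - k) - a (n - k - 1)) * ln (1 + v * D (Suc k))) + a n * ln (1 + u / b))
        + l ^ n * (v / (b ^ n + v * gamma_sum l b n))"
    by (simp only: last)
  have rhs: "iterated_exponent a b l n v
      = (\<Sum>k<n. (a (n - k) - a (n - k - 1)) * ln (1 + v * D (Suc k)))
        + l ^ n * (v / (b ^ n + v * gamma_sum l b n))"
    by (simp only: iterated_exponent_def D_def Suc_eq_plus1)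
  show ?thesis
    unfolding v_def[symmetric] lhs rhs by (simp add: left_diff_distrib)
qed

text \<open>Summation by parts, as an induction with shifted weights. Single increments of
  \<open>a\<close> may be negative, so the bound \<open>e 0 * a n\<close> is carried along instead
  of \<open>0\<close>: the peeled term contributes \<open>- e 0 * a n\<close>, which
  \<open>e 1 * a n\<close> from the induction hypothesis compensates.\<close>

lemma weighted_increments_nonneg:
  fixes a e :: "nat \<Rightarrow> real"
  assumes a: "a 0 = 0" "\<And>i. i \<le> n \<Longrightarrow> 0 \<le> a i"
    and e: "\<And>k. 0 \<le> e k" "\<And>k. e k \<le> e (Suc k)"
  shows "e 0 * a n \<le> (\<Sum>k<n. e k * (a (n - k) - a (n - k - 1)))"
  using a(2) e
proof (induction n arbitrary: e)
  case (Suc n)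
  have "e (Suc 0) * a n \<le> (\<Sum>k<n. e (Suc k) * (a (n - k) - a (n - k - 1)))"
    using Suc.prems by (intro Suc.IH[of "\<lambda>k. e (Suc k)"]) auto
  moreover have "e 0 * a n \<le> e (Suc 0) * a n"
    using Suc.prems by (intro mult_right_mono) auto
  ultimately show ?case
    by (subst sum.lessThan_Suc_shift) (simp add: algebra_simps)
qed (simp add: a(1))

subsection \<open>Frullani integrals and Levy densities\<close>

lemma nn_integral_exp_Ioi:
  assumes "0 < (c::real)"
  shows "(\<integral>\<^sup>+s. ennreal (exp (- c * s)) * indicator {0<..} s \<partial>lborel) = ennreal (1 / c)"
proof -
  have "(\<integral>\<^sup>+s. ennreal (exp (- c * s)) * indicator {0<..} s \<partial>lborel)
      = (\<integral>\<^sup>+s. ennreal (exp (- c * s)) * indicator {0..} s \<partial>lborel)"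
    using AE_lborel_singleton[of 0] by (intro nn_integral_cong_AE) (auto split: split_indicator)
  also have "\<dots> = ennreal (0 - (- exp (- c * 0) / c))"
  proof (rule nn_integral_FTC_atLeast)
    show "((\<lambda>s. - exp (- c * s) / c) has_real_derivative exp (- c * s)) (at s)" for s
      using assms by (auto intro!: derivative_eq_intros)
    have "filterlim (\<lambda>s. - c * s) at_bot at_top"
      using assms by (intro filterlim_tendsto_neg_mult_at_bot[OF tendsto_const _ filterlim_ident]) simp
    from filterlim_compose[OF exp_at_bot this]
    have "((\<lambda>s. - exp (- c * s) / c) \<longlongrightarrow> - 0 / c) at_top"
      by (intro tendsto_intros) (use assms in auto)
    then show "((\<lambda>s. - exp (- c * s) / c) \<longlongrightarrow> 0) at_top" by simp
  qed auto
  finally show ?thesis by simp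
qed

lemma has_bochner_integral_exp_Ioi:
  assumes "0 < (c::real)"
  shows "has_bochner_integral lborel (\<lambda>s. exp (- c * s) * indicator {0<..} s) (1 / c)"
proof (rule has_bochner_integral_nn_integral)
  have "(\<integral>\<^sup>+s. ennreal (exp (- c * s) * indicator {0<..} s) \<partial>lborel)
      = (\<integral>\<^sup>+s. ennreal (exp (- c * s)) * indicator {0<..} s \<partial>lborel)"
    by (intro nn_integral_cong) (auto split: split_indicator)
  with nn_integral_exp_Ioi[OF assms]
  show "(\<integral>\<^sup>+s. ennreal (exp (- c * s) * indicator {0<..} s) \<partial>lborel) = ennreal (1 / c)" by simp
qed (use assms in auto)

text \<open>A difference of two exponential integrals with rates \<open>c\<close> and
  \<open>c + u\<close>; it accounts for the rational term of the exponent.\<close>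

lemma has_bochner_integral_one_minus_exp:
  assumes "0 < (c::real)" "0 \<le> u"
  shows "has_bochner_integral lborel
    (\<lambda>s. exp (- c * s) * indicator {0<..} s * (1 - exp (- u * s))) (1 / c - 1 / (c + u))"
proof -
  have "has_bochner_integral lborel
      (\<lambda>s. exp (- c * s) * indicator {0<..} s - exp (- (c + u) * s) * indicator {0<..} s)
      (1 / c - 1 / (c + u))"
    using assms by (intro has_bochner_integral_diff has_bochner_integral_exp_Ioi) auto
  then show ?thesis
    by (rule has_bochner_integral_cong[THEN iffD1, rotated -1])
       (auto simp: algebra_simps exp_add[symmetric])
qed

text \<open>Frullani's integral: write \<open>(1 - exp (- u s)) / s\<close> as \<open>\<integral>\<^sub>0\<^sup>u exp (- x s) dx\<close> and swap the integrals.\<close>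

lemma has_bochner_integral_frullani:
  assumes c: "0 < (c::real)" and u: "0 \<le> u"
  shows "has_bochner_integral lborel
    (\<lambda>s. exp (- c * s) / s * indicator {0<..} s * (1 - exp (- u * s))) (ln (1 + u / c))"
proof (rule has_bochner_integral_nn_integral)
  \<comment> \<open>Both integration ranges are encoded as indicators, so that Tonelli applies on
    the full product of lines.\<close>
  define h where "h x s = ennreal (exp (- (c + x) * s)) * indicator {0<..} s * indicator {0..u} x" for x s :: real
  have h [measurable]: "(\<lambda>p. h (fst p) (snd p)) \<in> borel_measurable (lborel \<Otimes>\<^sub>M lborel)"
    unfolding h_def by measurable
  have inner: "ennreal (exp (- c * s) / s * indicator {0<..} s * (1 - exp (- u * s)))
      = (\<integral>\<^sup>+x. h x s \<partial>lborel)" for s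
  proof (cases "0 < s")
    case True
    have "(\<integral>\<^sup>+x. ennreal (exp (- (c + x) * s)) * indicator {0..u} x \<partial>lborel)
        = ennreal ((- exp (- (c + u) * s) / s) - (- exp (- (c + 0) * s) / s))"
    proof (rule nn_integral_FTC_Icc)
      show "((\<lambda>x. - exp (- (c + x) * s) / s) has_real_derivative exp (- (c + x) * s)) (at x)" for x
        using True by (auto intro!: derivative_eq_intros)
    qed (use u in auto)
    also have "(- exp (- (c + u) * s) / s) - (- exp (- (c + 0) * s) / s) = exp (- c * s) / s * (1 - exp (- u * s))"
      using True by (simp add: field_simps exp_add[symmetric])
    finally show ?thesis using True by (simp add: h_def)
  qed (simp add: h_def)
  have outer: "(\<integral>\<^sup>+s. h x s \<partial>lborel) = ennreal (1 / (c + x)) * indicator {0..u} x" for x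
  proof (cases "x \<in> {0..u}")
    case True
    then have "0 < c + x" using c by simp
    from nn_integral_exp_Ioi[OF this] show ?thesis
      using True by (simp add: h_def)
  qed (simp add: h_def)
  have "(\<integral>\<^sup>+s. ennreal (exp (- c * s) / s * indicator {0<..} s * (1 - exp (- u * s))) \<partial>lborel)
      = (\<integral>\<^sup>+s. \<integral>\<^sup>+x. h x s \<partial>lborel \<partial>lborel)"
    by (simp only: inner)
  also have "\<dots> = (\<integral>\<^sup>+x. \<integral>\<^sup>+s. h x s \<partial>lborel \<partial>lborel)"
    using h by (intro lborel_pair.Fubini') (simp add: case_prod_beta')
  also have "\<dots> = (\<integral>\<^sup>+x. ennreal (1 / (c + x)) * indicator {0..u} x \<partial>lborel)"
    by (simp only: outer)
  also have "\<dots> = ennreal (ln (c + u) - ln (c + 0))"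
  proof (rule nn_integral_FTC_Icc)
    show "((\<lambda>x. ln (c + x)) has_real_derivative 1 / (c + x)) (at x)" if "x \<in> {0..u}" for x
      using that c by (auto intro!: derivative_eq_intros)
  qed (use u c in auto)
  also have "ln (c + u) - ln (c + 0) = ln (1 + u / c)"
    using c u by (simp add: ln_divide_pos[symmetric] field_simps)
  finally show "(\<integral>\<^sup>+s. ennreal (exp (- c * s) / s * indicator {0<..} s * (1 - exp (- u * s))) \<partial>lborel)
      = ennreal (ln (1 + u / c))" .
qed (use c u in \<open>auto split: split_indicator intro!: AE_I2 mult_nonneg_nonneg\<close>)

text \<open>The bound \<open>min 1 s \<le> s\<close> removes the pole of \<open>1 / s\<close> at
  \<open>0\<close> and leaves \<open>exp (- c * s)\<close> as a majorant.\<close>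

lemma integrable_exp_over_min:
  assumes "0 < (c::real)"
  shows "integrable lborel (\<lambda>s. exp (- c * s) / s * indicator {0<..} s * min 1 s)"
proof (rule Bochner_Integration.integrable_bound)
  show "integrable lborel (\<lambda>s. exp (- c * s) * indicator {0<..} s)"
    using has_bochner_integral_exp_Ioi[OF assms] by (rule integrable.intros)
  show "AE s in lborel. norm (exp (- c * s) / s * indicator {0<..} s * min 1 s)
      \<le> norm (exp (- c * s) * indicator {0<..} s)"
    by (intro AE_I2) (auto simp: divide_le_eq min_def split: split_indicator)
qed measurable

lemma integrable_exp_min:
  assumes "0 < (c::real)"
  shows "integrable lborel (\<lambda>s. exp (- c * s) * indicator {0<..} s * min 1 s)"
proof (rule Bochner_Integration.integrable_bound)
  show "integrable lborel (\<lambda>s. exp (- c * s) * indicator {0<..} s)"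
    using has_bochner_integral_exp_Ioi[OF assms] by (rule integrable.intros)
  show "AE s in lborel. norm (exp (- c * s) * indicator {0<..} s * min 1 s)
      \<le> norm (exp (- c * s) * indicator {0<..} s)"
    by (intro AE_I2) (auto simp: min_def split: split_indicator)
qed measurable

text \<open>The weights \<open>w k\<close> may have either sign, so nonnegativity is asked of the
  whole density only. The integrals are evaluated termwise as Bochner integrals: Frullani gives the
  logarithms, the exponential difference the rational term.\<close>

lemma has_levy_densityI:
  fixes n :: nat and c w :: "nat \<Rightarrow> real"
  assumes c: "\<And>k. k < n \<Longrightarrow> 0 < c k" and d: "0 < d"
    and nonneg: "\<And>s. 0 < s \<Longrightarrow> 0 \<le> inverse s * (\<Sum>k<n. exp (- s * c k) * w k) + exp (- s * d) * K"
    and f: "has_laplace_exponent M X f"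
    and f_eq: "\<And>u. 0 \<le> u \<Longrightarrow> f u = (\<Sum>k<n. w k * ln (1 + u / c k)) + K * (1 / d - 1 / (d + u))"
  shows "has_levy_density M X (\<lambda>s. inverse s * (\<Sum>k<n. exp (- s * c k) * w k) + exp (- s * d) * K)"
proof -
  define g where "g s = inverse s * (\<Sum>k<n. exp (- s * c k) * w k) + exp (- s * d) * K" for s
  have g [measurable]: "g \<in> borel_measurable borel" unfolding g_def by measurable
  let ?\<nu> = "density lborel (\<lambda>s. ennreal (g s) * indicator {0<..} s)"
  \<comment> \<open>With the indicator inside \<open>ennreal\<close>, the rules for real-valued
    densities apply.\<close>
  have \<nu>: "?\<nu> = density lborel (\<lambda>s. ennreal (g s * indicator {0<..} s))"
    by (intro arg_cong[where f = "density lborel"] ext) (auto split: split_indicator)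
  have g0: "0 \<le> g s * indicator {0<..} s" for s
    using nonneg[of s] by (auto simp: g_def split: split_indicator)
  \<comment> \<open>The factor \<open>h\<close> is left open: \<open>min 1 s\<close> gives
    integrability, \<open>1 - exp (- u * s)\<close> gives the exponent.\<close>
  have split: "g s * indicator {0<..} s * h s
      = (\<Sum>k<n. w k * (exp (- c k * s) / s * indicator {0<..} s * h s))
        + K * (exp (- d * s) * indicator {0<..} s * h s)" for h :: "real \<Rightarrow> real" and s
    by (simp add: g_def sum_distrib_left sum_distrib_right algebra_simps divide_inverse)
  have int_min: "integrable ?\<nu> (\<lambda>s. min 1 s)"
  proof -
    have "integrable lborel (\<lambda>s. g s * indicator {0<..} s * min 1 s)"
      unfolding split using c d
      by (intro Bochner_Integration.integrable_add Bochner_Integration.integrable_sum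
          integrable_mult_right integrable_exp_over_min integrable_exp_min) auto
    then show ?thesis
      unfolding \<nu> using g0 by (subst integrable_real_density) auto
  qed
  have exponent: "(\<integral>s. (1 - exp (- u * s)) \<partial>?\<nu>) = f u" if u: "0 \<le> u" for u
  proof -
    have "has_bochner_integral lborel (\<lambda>s. g s * indicator {0<..} s * (1 - exp (- u * s)))
        ((\<Sum>k<n. w k * ln (1 + u / c k)) + K * (1 / d - 1 / (d + u)))"
      unfolding split[where h = "\<lambda>s. 1 - exp (- u * s)"]
      using c d u
      by (intro has_bochner_integral_add has_bochner_integral_sum has_bochner_integral_mult_right
            has_bochner_integral_frullani has_bochner_integral_one_minus_exp) auto
    then have "(\<integral>s. g s * indicator {0<..} s * (1 - exp (- u * s)) \<partial>lborel) = f u"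
      using f_eq[OF u] by (simp add: has_bochner_integral_integral_eq)
    then show ?thesis
      unfolding \<nu> using g0 by (subst integral_real_density) auto
  qed
  have "has_laplace_exponent M X (\<lambda>u. \<integral>s. (1 - exp (- u * s)) \<partial>?\<nu>)"
    using f exponent by (simp add: has_laplace_exponent_def)
  moreover have "emeasure ?\<nu> {..0} = 0"
    by (subst emeasure_density) (auto simp: nn_integral_0_iff_AE split: split_indicator)
  ultimately have "has_levy_measure M X ?\<nu>"
    unfolding has_levy_measure_def using int_min by simp
  then show ?thesis
    using nonneg unfolding has_levy_density_def g_def by blast
qed

subsection \<open>The iterated process\<close>

text \<open>
  Expressing \<open>X\<^sub>i\<close> as a measurable functional of the driving processes used so far makes it
  independent of the next one.
\<close>

definition path_functional ::
  "'a measure \<Rightarrow> ('j \<Rightarrow> 'a \<Rightarrow> real \<Rightarrow> real) \<Rightarrow> 'j set \<Rightarrow> (real \<Rightarrow> 'a \<Rightarrow> real) \<Rightarrow> bool" where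
  "path_functional M W K X \<longleftrightarrow>
     (\<exists>\<Phi> \<in> measurable (PiM K (\<lambda>_. path_space)) path_space.
        \<forall>\<omega>\<in>space M. path_of X \<omega> = \<Phi> (\<lambda>j\<in>K. W j \<omega>))"

lemma path_functional_identity: "path_functional M W K (\<lambda>t \<omega>. t)"
  unfolding path_functional_def path_of_def
  by (intro bexI[of _ "\<lambda>_. \<lambda>t\<in>{0..}. t"] ballI measurable_restrict) auto

lemma path_functional_drift:
  assumes "path_functional M W K X"
  shows "path_functional M W K (\<lambda>t \<omega>. c * t + X t \<omega>)"
proof -
  from assms obtain \<Phi> where \<Phi>: "\<Phi> \<in> measurable (PiM K (\<lambda>_. path_space)) path_space"
    and eq: "\<And>\<omega>. \<omega> \<in> space M \<Longrightarrow> path_of X \<omega> = \<Phi> (\<lambda>j\<in>K. W j \<omega>)"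
    unfolding path_functional_def by blast
  have "(\<lambda>w. \<lambda>t\<in>{0..}. c * t + \<Phi> w t) \<in> measurable (PiM K (\<lambda>_. path_space)) path_space"
  proof (rule measurable_restrict)
    fix t :: real assume "t \<in> {0..}"
    from measurable_compose[OF \<Phi> measurable_component_singleton[OF this]]
    show "(\<lambda>w. c * t + \<Phi> w t) \<in> borel_measurable (PiM K (\<lambda>_. path_space))" by simp
  qed
  then show ?thesis
    unfolding path_functional_def
    by (rule bexI[rotated]) (auto simp: eq[symmetric] path_of_def fun_eq_iff)
qed

lemma path_functional_time_change:
  assumes "path_functional M W K X" and X: "subordinator M X" and Y: "subordinator M Y"
    and W: "\<And>\<omega>. W j \<omega> = path_of Y \<omega>"
  shows "path_functional M W (insert j K) (\<lambda>t \<omega>. Y (X t \<omega>) \<omega>)"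
proof -
  from assms(1) obtain \<Phi> where \<Phi>: "\<Phi> \<in> measurable (PiM K (\<lambda>_. path_space)) path_space"
    and eq: "\<And>\<omega>. \<omega> \<in> space M \<Longrightarrow> path_of X \<omega> = \<Phi> (\<lambda>j\<in>K. W j \<omega>)"
    unfolding path_functional_def by blast
  \<comment> \<open>Coordinate \<open>j\<close> supplies the path of \<open>Y\<close>; the
    restriction to \<open>K\<close> is the input from which \<open>\<Phi>\<close> rebuilds the
    random clock.\<close>
  define \<Psi> where "\<Psi> w = (\<lambda>t\<in>{0..}. right_eval (w j) (\<Phi> (restrict w K) t))" for w
  have "\<Psi> \<in> measurable (PiM (insert j K) (\<lambda>_. path_space)) path_space"
    unfolding \<Psi>_def
  proof (rule measurable_restrict)
    fix t :: real assume t: "t \<in> {0..}"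
    have "(\<lambda>w. \<Phi> (restrict w K) t) \<in> borel_measurable (PiM (insert j K) (\<lambda>_. path_space))"
      by (intro measurable_compose[OF measurable_restrict_subset] measurable_compose[OF \<Phi>]
          measurable_component_singleton[OF t]) auto
    moreover have "(\<lambda>w. w j) \<in> measurable (PiM (insert j K) (\<lambda>_. path_space)) path_space"
      by (rule measurable_component_singleton) simp
    ultimately have "(\<lambda>w. (w j, \<Phi> (restrict w K) t))
        \<in> measurable (PiM (insert j K) (\<lambda>_. path_space)) (path_space \<Otimes>\<^sub>M borel)"
      by simp
    from measurable_compose[OF this measurable_right_eval]
    show "(\<lambda>w. right_eval (w j) (\<Phi> (restrict w K) t))
        \<in> borel_measurable (PiM (insert j K) (\<lambda>_. path_space))" by simp
  qed
  moreover have "path_of (\<lambda>t \<omega>. Y (X t \<omega>) \<omega>) \<omega> = \<Psi> (\<lambda>i\<in>insert j K. W i \<omega>)" if w: "\<omega> \<in> space M" for \<omega>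
  proof -
    have "insert j K \<inter> K = K" by auto
    then show ?thesis
      unfolding \<Psi>_def path_of_def[of "\<lambda>t \<omega>. Y (X t \<omega>) \<omega>"]
      by (auto simp: eq[OF w, symmetric] W right_eval_subordinator[OF Y w] subordinator_nonneg[OF X w] fun_eq_iff)
  qed
  ultimately show ?thesis
    unfolding path_functional_def by blast
qed

context prob_space
begin

text \<open>Disjoint blocks of an independent family are independent, and so are measurable
  functionals of them; \<open>j \<notin> K\<close> makes the blocks disjoint.\<close>

lemma indep_var_path_functional:
  assumes W: "indep_vars (\<lambda>_. path_space) W I" and "path_functional M W K X"
    and K: "K \<subseteq> I" "j \<in> I" "j \<notin> K" and Wj: "\<And>\<omega>. W j \<omega> = path_of Y \<omega>"
  shows "indep_var path_space (path_of X) path_space (path_of Y)"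
proof -
  from assms(2) obtain \<Phi> where \<Phi>: "\<Phi> \<in> measurable (PiM K (\<lambda>_. path_space)) path_space"
    and eq: "\<And>\<omega>. \<omega> \<in> space M \<Longrightarrow> path_of X \<omega> = \<Phi> (\<lambda>j\<in>K. W j \<omega>)"
    unfolding path_functional_def by blast
  have "indep_var (PiM K (\<lambda>_. path_space)) (\<lambda>\<omega>. \<lambda>i\<in>K. W i \<omega>)
      (PiM {j} (\<lambda>_. path_space)) (\<lambda>\<omega>. \<lambda>i\<in>{j}. W i \<omega>)"
    by (rule indep_var_restrict[OF W]) (use K in auto)
  moreover have "(\<lambda>w. w j) \<in> measurable (PiM {j} (\<lambda>_. path_space)) path_space"
    by (rule measurable_component_singleton) simp
  ultimately have "indep_var path_space (\<Phi> \<circ> (\<lambda>\<omega>. \<lambda>i\<in>K. W i \<omega>))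
      path_space ((\<lambda>w. w j) \<circ> (\<lambda>\<omega>. \<lambda>i\<in>{j}. W i \<omega>))"
    using \<Phi> by (intro indep_var_compose)
  then have ind: "indep_var path_space (\<lambda>\<omega>. \<Phi> (\<lambda>i\<in>K. W i \<omega>)) path_space (path_of Y)"
    by (simp add: comp_def Wj[abs_def])
  \<comment> \<open>The representation through \<open>\<Phi>\<close> holds only on
    \<open>space M\<close>, so independence is transferred via equality of laws.\<close>
  have "path_of X \<in> measurable M path_space"
    using indep_var_rv1[OF ind] by (rule measurable_cong[THEN iffD1, rotated]) (simp add: eq)
  moreover have "distr M path_space (path_of X) = distr M path_space (\<lambda>\<omega>. \<Phi> (\<lambda>i\<in>K. W i \<omega>))"
    by (intro distr_cong refl eq)
  moreover have "distr M (path_space \<Otimes>\<^sub>M path_space) (\<lambda>\<omega>. (path_of X \<omega>, path_of Y \<omega>))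
      = distr M (path_space \<Otimes>\<^sub>M path_space) (\<lambda>\<omega>. (\<Phi> (\<lambda>i\<in>K. W i \<omega>), path_of Y \<omega>))"
    by (intro distr_cong refl) (simp add: eq)
  ultimately show ?thesis
    using ind by (simp add: indep_var_distribution_eq)
qed

end

section \<open>Inductive construction of the processes, with parameters varying in
  \<open>i\<close>\<close>

locale iterated_process_setup = prob_space M
  for M :: "'a measure" and n :: nat and a \<beta> lam :: "nat \<Rightarrow> real"
    and E :: "nat \<Rightarrow> real \<Rightarrow> 'a \<Rightarrow> real" and N :: "nat \<Rightarrow> real \<Rightarrow> 'a \<Rightarrow> nat" +
  assumes params: "\<And>i. i \<in> {1..n} \<Longrightarrow> 0 \<le> a i \<and> 0 < \<beta> i \<and> 0 < lam i"
    and E: "\<And>i. i \<in> {1..n} \<Longrightarrow> exponential_process M (\<beta> i) (E i)"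
    and N: "\<And>i. i \<in> {1..n} \<Longrightarrow> poisson_process M (lam i) (N i)"
    and indep: "independent_processes M n E N"
begin

abbreviation X :: "nat \<Rightarrow> real \<Rightarrow> 'a \<Rightarrow> real" where
  "X \<equiv> iterated_process a E N"

definition driver :: "nat + nat \<Rightarrow> 'a \<Rightarrow> real \<Rightarrow> real" where
  "driver j = (case j of Inl i \<Rightarrow> path_of (E i) | Inr i \<Rightarrow> path_of (\<lambda>t \<omega>. real (N i t \<omega>)))"

lemma indep_drivers: "indep_vars (\<lambda>_. path_space) driver ({1..n} <+> {1..n})"
proof -
  have "driver = (\<lambda>j \<omega>. \<lambda>t\<in>{0..}. case j of Inl i \<Rightarrow> E i t \<omega> | Inr i \<Rightarrow> real (N i t \<omega>))"
    by (auto simp: driver_def path_of_def fun_eq_iff split: sum.split)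
  with indep show ?thesis
    by (simp add: independent_processes_def)
qed

text \<open>One stage is a Poisson process run at the clock \<open>X i\<close>, then a drift, then
  \<open>E\<close> run at the result. Exponents compose in reverse order, so \<open>u\<close> passes
  through the exponent of \<open>E\<close> first.\<close>

lemma iterated_process_step:
  assumes i: "Suc i \<le> n" and X: "subordinator M (X i)"
    and XF: "path_functional M driver ({1..i} <+> {1..i}) (X i)"
  shows "subordinator M (X (Suc i))"
    and "path_functional M driver ({1..Suc i} <+> {1..Suc i}) (X (Suc i))"
    and "has_laplace_exponent M (X i) f \<Longrightarrow> has_laplace_exponent M (X (Suc i))
      (\<lambda>u. a (Suc i) * ln (1 + u / \<beta> (Suc i)) + f (lam (Suc i) * (1 - exp (- ln (1 + u / \<beta> (Suc i))))))"
proof -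
  let ?K = "{1..i} <+> {1..i}" and ?j = "Suc i"
  let ?I = "{1..n} <+> {1..n}"
  have j: "?j \<in> {1..n}" using i by simp
  have a: "0 \<le> a ?j" and \<beta>: "0 < \<beta> ?j" and l: "0 < lam ?j" using params[OF j] by auto
  have NS: "subordinator M (\<lambda>t \<omega>. real (N ?j t \<omega>))" using N[OF j] by (simp add: poisson_process_def)
  have ES: "subordinator M (E ?j)" and EL: "has_laplace_exponent M (E ?j) (\<lambda>u. ln (1 + u / \<beta> ?j))"
    using E[OF j] by (simp_all add: exponential_process_def)
  have drN: "driver (Inr ?j) \<omega> = path_of (\<lambda>t \<omega>. real (N ?j t \<omega>)) \<omega>" for \<omega> by (simp add: driver_def)
  have drE: "driver (Inl ?j) \<omega> = path_of (E ?j) \<omega>" for \<omega> by (simp add: driver_def)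
  have indN: "indep_var path_space (path_of (X i)) path_space (path_of (\<lambda>t \<omega>. real (N ?j t \<omega>)))"
    by (rule indep_var_path_functional[OF indep_drivers XF _ _ _ drN]) (use i in auto)
  define Y where "Y t \<omega> = real (N ?j (X i t \<omega>) \<omega>)" for t \<omega>
  define Z where "Z t \<omega> = a ?j * t + Y t \<omega>" for t \<omega>
  have YS: "subordinator M Y"
    unfolding Y_def[abs_def] by (rule subordinator_time_change[OF X NS indN])
  have ZS: "subordinator M Z"
    unfolding Z_def[abs_def] by (rule subordinator_drift[OF YS a])
  have YF: "path_functional M driver (insert (Inr ?j) ?K) Y"
    unfolding Y_def[abs_def] by (rule path_functional_time_change[OF XF X NS drN])
  have ZF: "path_functional M driver (insert (Inr ?j) ?K) Z"
    unfolding Z_def[abs_def] by (rule path_functional_drift[OF YF])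
  \<comment> \<open>\<open>Z\<close> has consumed the Poisson driver of this stage but not the
    exponential one, so \<open>E ?j\<close> is still fresh.\<close>
  have indE: "indep_var path_space (path_of Z) path_space (path_of (E ?j))"
    by (rule indep_var_path_functional[OF indep_drivers ZF _ _ _ drE]) (use i in auto)
  have X_Suc: "X ?j = (\<lambda>t \<omega>. E ?j (Z t \<omega>) \<omega>)"
    by (simp add: Z_def Y_def)
  show "subordinator M (X ?j)"
    unfolding X_Suc by (rule subordinator_time_change[OF ZS ES indE])
  have "insert (Inl ?j) (insert (Inr ?j) ?K) = {1..?j} <+> {1..?j}"
    by (auto simp: atLeastAtMostSuc_conv)
  with path_functional_time_change[OF ZF ZS ES drE]
  show "path_functional M driver ({1..?j} <+> {1..?j}) (X ?j)"
    unfolding X_Suc by simp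
  assume f: "has_laplace_exponent M (X i) f"
  have "has_laplace_exponent M Y (\<lambda>u. f (lam ?j * (1 - exp (- u))))"
    unfolding Y_def[abs_def]
    by (rule has_laplace_exponent_time_change[OF X NS indN f has_laplace_exponent_poisson[OF N[OF j] l]])
       (use l in auto)
  then have "has_laplace_exponent M Z (\<lambda>u. a ?j * u + f (lam ?j * (1 - exp (- u))))"
    unfolding Z_def[abs_def] by (rule has_laplace_exponent_drift)
  from has_laplace_exponent_time_change[OF ZS ES indE this EL]
  show "has_laplace_exponent M (X ?j)
      (\<lambda>u. a ?j * ln (1 + u / \<beta> ?j) + f (lam ?j * (1 - exp (- ln (1 + u / \<beta> ?j)))))"
    unfolding X_Suc using \<beta> by simp
qed

lemma iterated_process_subordinator:
  assumes "i \<le> n"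
  shows "subordinator M (X i) \<and> path_functional M driver ({1..i} <+> {1..i}) (X i)"
  using assms
proof (induction i)
  case 0
  then show ?case
    using subordinator_identity path_functional_identity by simp
next
  case (Suc i)
  then show ?case
    using iterated_process_step(1,2)[of i] by auto
qed

lemma iterated_process_laplace_exponent:
  assumes const: "\<And>i. i \<in> {1..n} \<Longrightarrow> \<beta> i = b \<and> lam i = l" and a0: "a 0 = 0" and "i \<le> n"
  shows "has_laplace_exponent M (X i) (iterated_exponent a b l i)"
  using \<open>i \<le> n\<close>
proof (induction i)
  \<comment> \<open>For index \<open>0\<close> the closed form reduces to
    \<open>u / (1 + u * 0) = u\<close>, the exponent of the deterministic clock.\<close>
  case 0
  then show ?case
    using has_laplace_exponent_identity by (simp add: iterated_exponent_def[abs_def])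
next
  case (Suc i)
  then have j: "Suc i \<in> {1..n}" by simp
  have bl: "\<beta> (Suc i) = b" "lam (Suc i) = l" "0 < b" "0 < l" using const[OF j] params[OF j] by auto
  have sub: "subordinator M (X i)" "path_functional M driver ({1..i} <+> {1..i}) (X i)"
    using iterated_process_subordinator[of i] Suc.prems by auto
  have IH: "has_laplace_exponent M (X i) (iterated_exponent a b l i)" using Suc by simp
  have "a (Suc i) * ln (1 + u / b) + iterated_exponent a b l i (l * (1 - exp (- ln (1 + u / b))))
      = iterated_exponent a b l (Suc i) u" if u: "0 \<le> u" for u
  proof -
    have "0 < 1 + u / b" "b + u \<noteq> 0" using u bl by (auto simp: add_pos_nonneg)
    \<comment> \<open>Here \<open>exp (- ln (1 + u / b)) = b / (b + u)\<close>, which turns the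
      Poisson exponent into the argument used by the recursion.\<close>
    then have "l * (1 - exp (- ln (1 + u / b))) = l * u / (b + u)"
      using bl by (simp add: exp_minus field_simps)
    then show ?thesis using iterated_exponent_Suc[of b l u a, OF bl(3,4) u a0] by simp
  qed
  with iterated_process_step(3)[OF Suc.prems sub IH] bl show ?case
    unfolding has_laplace_exponent_def by simp
qed

lemma iterated_process_levy_density:
  assumes const: "\<And>i. i \<in> {1..n} \<Longrightarrow> \<beta> i = b \<and> lam i = l" and a0: "a 0 = 0" and n: "1 \<le> n"
  shows "has_levy_density M (X n) (\<lambda>u.
    inverse u * (\<Sum>k<n. exp (- u * (b ^ (k + 1) / gamma_sum l b (k + 1))) * (a (n - k) - a (n - k - 1)))
    + exp (- u * (b ^ n / gamma_sum l b n)) * ((l * b) ^ n / (gamma_sum l b n)\<^sup>2))"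
proof (rule has_levy_densityI)
  have bl: "0 < b" "0 < l" using const[of 1] params[of 1] n by auto
  have a: "0 \<le> a i" if "i \<le> n" for i
    using params[of i] a0 that by (cases "i = 0") auto
  have \<gamma>: "0 < gamma_sum l b (k + 1)" for k using gamma_sum_pos[OF bl] by simp
  have \<gamma>n: "0 < gamma_sum l b n" using gamma_sum_pos[OF bl] n by simp
  show "0 < b ^ (k + 1) / gamma_sum l b (k + 1)" for k
    using \<gamma> bl by (intro divide_pos_pos) auto
  show "0 < b ^ n / gamma_sum l b n" using \<gamma>n bl by simp
  show "0 \<le> inverse s * (\<Sum>k<n. exp (- s * (b ^ (k + 1) / gamma_sum l b (k + 1))) * (a (n - k) - a (n - k - 1)))
      + exp (- s * (b ^ n / gamma_sum l b n)) * ((l * b) ^ n / (gamma_sum l b n)\<^sup>2)" if s: "0 < s" for s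
  proof -
    define e where "e k = exp (- s * (b ^ (k + 1) / gamma_sum l b (k + 1)))" for k
    \<comment> \<open>The decay rates fall as \<open>k\<close> grows, so for \<open>s > 0\<close>
      the weights rise, as the summation by parts requires.\<close>
    have "e k \<le> e (Suc k)" for k
    proof -
      have "b ^ (Suc k + 1) / gamma_sum l b (Suc k + 1) \<le> b ^ (k + 1) / gamma_sum l b (k + 1)"
        using gamma_sum_ratio_antimono[OF bl, of "k + 1"] by simp
      from mult_left_mono[OF this, of s] s show ?thesis
        by (simp only: e_def exp_le_cancel_iff mult_minus_left neg_le_iff_le)
    qed
    then have "e 0 * a n \<le> (\<Sum>k<n. e k * (a (n - k) - a (n - k - 1)))"
      by (intro weighted_increments_nonneg a0 a) (auto simp: e_def)
    moreover have "0 \<le> e 0 * a n" using a[of n] by (simp add: e_def)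
    ultimately have "0 \<le> (\<Sum>k<n. e k * (a (n - k) - a (n - k - 1)))" by linarith
    then show ?thesis
      unfolding e_def using s bl by (intro add_nonneg_nonneg mult_nonneg_nonneg) auto
  qed
  show "has_laplace_exponent M (X n) (iterated_exponent a b l n)"
    by (rule iterated_process_laplace_exponent[OF const a0]) auto
  show "iterated_exponent a b l n u
      = (\<Sum>k<n. (a (n - k) - a (n - k - 1)) * ln (1 + u / (b ^ (k + 1) / gamma_sum l b (k + 1))))
        + (l * b) ^ n / (gamma_sum l b n)\<^sup>2
          * (1 / (b ^ n / gamma_sum l b n) - 1 / (b ^ n / gamma_sum l b n + u))" if u: "0 \<le> u" for u
  proof -
    \<comment> \<open>With \<open>d = B / G\<close>, the difference
      \<open>1 / d - 1 / (d + u)\<close> equals \<open>u * (G * G) / (B * (B + u * G))\<close>;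
      matching it with \<open>l ^ n * (u / (B + u * G))\<close> fixes the constant
      \<open>l ^ n * B / (G * G)\<close>.\<close>
    define G B where "G = gamma_sum l b n" and "B = b ^ n"
    have GB: "0 < G" "0 < B" "0 < B + u * G" using \<gamma>n bl u by (auto simp: G_def B_def add_pos_nonneg)
    have "1 / (B / G) - 1 / (B / G + u) = G / B - G / (B + u * G)"
      using GB by (simp add: field_simps)
    also have "\<dots> = u * G\<^sup>2 / (B * (B + u * G))"
      using GB by (simp add: diff_frac_eq power2_eq_square algebra_simps)
    finally have "l ^ n * (u / (B + u * G)) = l ^ n * B / G\<^sup>2 * (1 / (B / G) - 1 / (B / G + u))"
      using GB by simp
    then show ?thesis
      by (simp add: iterated_exponent_def G_def B_def power_mult_distrib)
  qed
qed

end

theorem theorem7: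
  fixes M :: "'a measure" and n :: nat
    and a \<beta> lam :: "nat \<Rightarrow> real"
    and E :: "nat \<Rightarrow> real \<Rightarrow> 'a \<Rightarrow> real"
    and N :: "nat \<Rightarrow> real \<Rightarrow> 'a \<Rightarrow> nat"
  assumes "prob_space M"
    and "n \<ge> 1"
    and "a 0 = 0"
    and "\<forall>i\<in>{1..n}. 0 \<le> a i \<and> 0 < \<beta> i \<and> 0 < lam i"
    and "\<forall>i\<in>{1..n}. exponential_process M (\<beta> i) (E i)"
    and "\<forall>i\<in>{1..n}. poisson_process M (lam i) (N i)"
    and "independent_processes M n E N"
  shows
    "subordinator M (iterated_process a E N n) \<and>
     ((\<forall>i\<in>{1..n}. \<beta> i = 1 \<and> lam i = 1) \<longrightarrow>
        has_levy_density M (iterated_process a E N n) (\<lambda>u.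
          inverse u * (\<Sum>k<n. exp (- u * (1 / (1 + real k))) * (a (n - k) - a (n - k - 1)))
          + exp (- u * (1 / real n)) * (1 / (real n)\<^sup>2)) \<and>
        has_laplace_exponent M (iterated_process a E N n) (\<lambda>u.
          (\<Sum>k<n. (a (n - k) - a (n - k - 1)) * ln (1 + u * (1 + real k)))
          + u / (1 + real n * u))) \<and>
     (\<forall>b l. b \<noteq> 1 \<longrightarrow> l \<noteq> 1 \<longrightarrow> (\<forall>i\<in>{1..n}. \<beta> i = b \<and> lam i = l) \<longrightarrow>
        has_levy_density M (iterated_process a E N n) (\<lambda>u.
          inverse u * (\<Sum>k<n. exp (- u * (b ^ (k + 1) / gamma_sum l b (k + 1)))
                               * (a (n - k) - a (n - k - 1)))
          + exp (- u * (b ^ n / gamma_sum l b n)) * ((l * b) ^ n / (gamma_sum l b n)\<^sup>2)) \<and>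
        has_laplace_exponent M (iterated_process a E N n) (\<lambda>u.
          (\<Sum>k<n. (a (n - k) - a (n - k - 1)) * ln (1 + u * (gamma_sum l b (k + 1) / b ^ (k + 1))))
          + l ^ n * (u / (b ^ n + u * gamma_sum l b n))) \<and>
        (l \<noteq> b \<longrightarrow> (\<forall>m. gamma_sum l b m = (l ^ m - b ^ m) * inverse (l - b))))"
proof -
  interpret iterated_process_setup M n a \<beta> lam E N
    using assms by (intro iterated_process_setup.intro iterated_process_setup_axioms.intro) auto
  show ?thesis
  proof (intro conjI allI impI)
    show "subordinator M (X n)" using iterated_process_subordinator by simp
  next
    assume one: "\<forall>i\<in>{1..n}. \<beta> i = 1 \<and> lam i = 1"
    show "has_levy_density M (X n) (\<lambda>u.
        inverse u * (\<Sum>k<n. exp (- u * (1 / (1 + real k))) * (a (n - k) - a (n - k - 1)))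
        + exp (- u * (1 / real n)) * (1 / (real n)\<^sup>2))"
      using iterated_process_levy_density[of 1 1] one assms(2,3) by (simp add: gamma_sum_one add.commute)
    show "has_laplace_exponent M (X n) (\<lambda>u.
        (\<Sum>k<n. (a (n - k) - a (n - k - 1)) * ln (1 + u * (1 + real k))) + u / (1 + real n * u))"
      using iterated_process_laplace_exponent[of 1 1 n] one assms(3)
      by (simp add: iterated_exponent_def[abs_def] gamma_sum_one add.commute mult.commute)
  next
    fix b l :: real
    assume const: "\<forall>i\<in>{1..n}. \<beta> i = b \<and> lam i = l"
    show "has_levy_density M (X n) (\<lambda>u.
        inverse u * (\<Sum>k<n. exp (- u * (b ^ (k + 1) / gamma_sum l b (k + 1))) * (a (n - k) - a (n - k - 1)))
        + exp (- u * (b ^ n / gamma_sum l b n)) * ((l * b) ^ n / (gamma_sum l b n)\<^sup>2))"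
      using const assms(2,3) by (intro iterated_process_levy_density) auto
    show "has_laplace_exponent M (X n) (\<lambda>u.
        (\<Sum>k<n. (a (n - k) - a (n - k - 1)) * ln (1 + u * (gamma_sum l b (k + 1) / b ^ (k + 1))))
        + l ^ n * (u / (b ^ n + u * gamma_sum l b n)))"
      using iterated_process_laplace_exponent[of b l n] const assms(3)
      by (simp only: iterated_exponent_def[abs_def])
    show "gamma_sum l b m = (l ^ m - b ^ m) * inverse (l - b)" if "l \<noteq> b" for m
      using that by (rule gamma_sum_closed_form)
  qed
qed

end
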